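(* Let $\mathbb{K}$ be an algebraically closed field, let $n\ge 1$ and $d\geq 1$ be integers, and let $\mathrm{H}\subset\mathbb{P}^n$ be a monoid hypersurface of degree $d$ having the point $(0:\dots:0:1)\in \mathrm{H}$ with multiplicity $d-1$, with implicit equation $$E(\underline{X})=f_{d-1}(X_1,\dots,X_n)X_{n+1}-f_d(X_1,\dots,X_n),$$ where $f_{d-1},f_d\in\mathbb{K}[t_1,\dots,t_n]$ are homogeneous of degrees $d-1$ and $d$ respectively, without common factors. Consider the parametrization $\phi:\mathbb{P}^{n-1}\dashrightarrow\mathbb{P}^n$ of $\mathrm{H}$ given by $\underline{t}\mapsto (t_1f_{d-1}(\underline{t}):\dots:t_nf_{d-1}(\underline{t}):f_d(\underline{t}))$, and let $\mathcal{K}$ be the kernel of the morphism of $\mathbb{K}[\underline{t}]$-algebras $$\mathfrak{h}:\mathbb{K}[\underline{t},\underline{X}]\to\mathbb{K}[\underline{t}][Z],\qquad X_i\mapsto t_if_{d-1}(\underline{t})Z\ (1\le i\le n),\qquad X_{n+1}\mapsto f_d(\underline{t})Z.$$ Let $p_{i,j}:=t_iX_j-t_jX_i$ for $1\le i<j\le n$, and let $F_{d-1},F_{d-2},\dots,F_0$ be any sequence of polynomials obtained by the recursive construction described in the context. Then $$\{p_{i,j}:\ 1\le i<j\le n\}\cup\{F_0,F_1,\dots,F_{d-1}\}$$ is a minimal set of generators of the ideal $\mathcal{K}$.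
   Context: Notation: $\underline{t}=(t_1,\dots,t_n)$, $\underline{X}=(X_1,\dots,X_{n+1})$, and $Z$ is a new variable. A monoid hypersurface is an irreducible algebraic hypersurface having a singularity of multiplicity one less than its degree. The ring $\mathbb{K}[\underline{t},\underline{X}]$ is bigraded by total degrees in $\underline{t}$ and in $\underline{X}$; $\mathcal{K}$ is a bigraded ideal, with $\mathcal{K}_{i,j}$ its piece of bidegree $(i,j)$. Construction of the $F_j$: - Write $f_d(\underline{t})=t_1f_{d,1}(\underline{t})+\dots+t_nf_{d,n}(\underline{t})$ with $f_{d,j}$ homogeneous of degree $d-1$ (any choice), and set $F_{d-1}(\underline{t},\underline{X}):=f_{d-1}(\underline{t})X_{n+1}-\sum_{j=1}^nf_{d,j}(\underline{t})X_j\in\mathcal{K}_{d-1,1}$. - For $j=d-1,d-2,\dots,1$: write $F_j\in\mathcal{K}_{j,d-j}$ as $F_j=\sum_{i=1}^nF_{j,i}(\underline{t},\underline{X})\,t_i$ with $F_{j,i}$ bihomogeneous of bidegree $(j-1,d-j)$ (any choice), and set $F_{j-1}(\underline{t},\underline{X}):=\sum_{i=1}^nF_{j,i}(\underline{t},\underline{X})\,X_i\in\mathcal{K}_{j-1,d-j+1}$. A minimal set of generators is a generating set in which no element belongs to the ideal generated by the others. *)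

theory Defs
  imports "HOL-Library.Poly_Mapping" "HOL-Computational_Algebra.Computational_Algebra"
begin

section \<open>Polynomials in finitely many variables\<close>

text \<open>
  \<open>('v, 'k) mpoly\<close> is the polynomial ring over \<open>'k\<close> whose variables are exactly the elements of
  \<open>'v\<close>. An element of \<open>'v \<Rightarrow>\<^sub>0 nat\<close> is an exponent vector.
\<close>

type_synonym ('v, 'k) mpoly = "('v \<Rightarrow>\<^sub>0 nat) \<Rightarrow>\<^sub>0 'k"

definition Const :: "'k::zero \<Rightarrow> ('v, 'k) mpoly" where
  "Const c = Poly_Mapping.single 0 c"

definition Var :: "'v \<Rightarrow> ('v, 'k::zero_neq_one) mpoly" where
  "Var v = Poly_Mapping.single (Poly_Mapping.single v 1) 1"

text \<open>The value of a polynomial after mapping coefficients by \<open>c\<close> and variables by \<open>s\<close>.\<close>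

definition msubst ::
  "('k::zero \<Rightarrow> 'r::comm_semiring_1) \<Rightarrow> ('v::finite \<Rightarrow> 'r) \<Rightarrow> ('v, 'k) mpoly \<Rightarrow> 'r" where
  "msubst c s p =
     (\<Sum>m\<in>Poly_Mapping.keys p. c (Poly_Mapping.lookup p m) *
        (\<Prod>v\<in>UNIV. s v ^ Poly_Mapping.lookup m v))"

definition mdeg :: "('v::finite \<Rightarrow>\<^sub>0 nat) \<Rightarrow> nat" where
  "mdeg m = (\<Sum>v\<in>UNIV. Poly_Mapping.lookup m v)"

text \<open>As usual, the zero polynomial is homogeneous of every degree.\<close>

definition homogeneous :: "nat \<Rightarrow> ('v::finite, 'k::zero) mpoly \<Rightarrow> bool" where
  "homogeneous d p \<longleftrightarrow> (\<forall>m\<in>Poly_Mapping.keys p. mdeg m = d)"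

text \<open>
  No instance of \<^class>\<open>algebraic_semidom\<close> is available for this ring, so the library's
  \<open>coprime\<close> is written out.
\<close>

definition no_common_factor :: "'a::comm_semiring_1 \<Rightarrow> 'a \<Rightarrow> bool" where
  "no_common_factor a b \<longleftrightarrow> (\<forall>c. c dvd a \<longrightarrow> c dvd b \<longrightarrow> c dvd 1)"


section \<open>Ideals\<close>

text \<open>The ideal generated by \<open>B\<close> is \<open>ideal.span B\<close>: the span in the ring as a module over itself.\<close>

global_interpretation ideal: module "(*) :: 'a::comm_ring_1 \<Rightarrow> 'a \<Rightarrow> 'a"
  by unfold_locales (simp_all add: algebra_simps)

definition minimal_generators :: "'a::comm_ring_1 set \<Rightarrow> 'a set \<Rightarrow> bool" where
  "minimal_generators B I \<longleftrightarrow>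
     ideal.span B = I \<and> (\<forall>b\<in>B. b \<notin> ideal.span (B - {b}))"


section \<open>Monoid hypersurfaces\<close>

text \<open>
  A point of projective space with coordinates indexed by \<open>'v\<close> is the class, modulo nonzero
  scalars, of a nonzero coordinate vector.
\<close>

definition proj_point :: "('v \<Rightarrow> 'k::field) \<Rightarrow> ('v \<Rightarrow> 'k) set" where
  "proj_point v = {(\<lambda>j. c * v j) | c. c \<noteq> 0}"

definition proj_zeros :: "('v::finite, 'k::field) mpoly \<Rightarrow> ('v \<Rightarrow> 'k) set set" where
  "proj_zeros E = {proj_point v | v. v \<noteq> (\<lambda>_. 0) \<and> msubst id v E = 0}"

text \<open>
  \<open>H\<close> is the irreducible hypersurface with implicit equation \<open>E\<close>. Over an algebraically closed
  field, \<open>H\<close> determines its irreducible equation \<open>E\<close> up to a nonzero scalar.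
\<close>

definition implicit_equation ::
  "('v::finite \<Rightarrow> 'k::field) set set \<Rightarrow> ('v, 'k) mpoly \<Rightarrow> bool" where
  "implicit_equation H E \<longleftrightarrow> irreducible E \<and> (\<exists>d. homogeneous d E) \<and> H = proj_zeros E"

text \<open>
  Multiplicity of the hypersurface \<open>E = 0\<close> at the point with coordinates \<open>P\<close>: in an affine chart
  around the point (the coordinate \<open>i\<close> is frozen at \<open>P i \<noteq> 0\<close>) move the point to the origin and take
  the least degree of a monomial that occurs. It is \<open>0\<close> exactly when the point does not lie on the
  hypersurface.
\<close>

definition multiplicity_at :: "('v::finite \<Rightarrow> 'k::field) \<Rightarrow> ('v, 'k) mpoly \<Rightarrow> nat" where
  "multiplicity_at P E =
     (let i = (SOME i. P i \<noteq> 0);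
          e = msubst Const (\<lambda>j. if j = i then Const (P i) else Var j + Const (P j)) E
      in LEAST k. \<exists>m\<in>Poly_Mapping.keys e. mdeg m = k)"

definition monoid_hypersurface ::
  "nat \<Rightarrow> ('v::finite \<Rightarrow> 'k::field) set set \<Rightarrow> ('v \<Rightarrow> 'k) \<Rightarrow> bool" where
  "monoid_hypersurface d H P \<longleftrightarrow>
     (\<exists>E. implicit_equation H E \<and> homogeneous d E \<and> multiplicity_at P E = d - 1)"

text \<open>
  The type \<open>'n\<close>, a finite linear order, indexes \<open>t\<^sub>1, \<dots>, t\<^sub>n\<close> (so \<open>n = CARD('n)\<close>);
  \<open>'n option\<close> indexes \<open>X\<^sub>1, \<dots>, X\<^sub>n\<^sub>+\<^sub>1\<close>, with \<open>None\<close> for the last one.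
\<close>

definition monoid_vertex :: "'n option \<Rightarrow> 'k::field" where
  "monoid_vertex j = (if j = None then 1 else 0)"

definition monoid_equation ::
  "('n::finite, 'k::field) mpoly \<Rightarrow> ('n, 'k) mpoly \<Rightarrow> ('n option, 'k) mpoly" where
  "monoid_equation fd1 fd =
     msubst Const (\<lambda>i. Var (Some i)) fd1 * Var None - msubst Const (\<lambda>i. Var (Some i)) fd"


section \<open>The bigraded ring and the kernel\<close>

text \<open>
  The variables of \<open>\<bbbK>[t, X]\<close> are indexed by \<open>'n + 'n option\<close>.
\<close>

type_synonym ('n, 'k) txpoly = "('n + 'n option, 'k) mpoly"

abbreviation tvar :: "'n \<Rightarrow> ('n, 'k::zero_neq_one) txpoly" where
  "tvar i \<equiv> Var (Inl i)"

abbreviation Xvar :: "'n \<Rightarrow> ('n, 'k::zero_neq_one) txpoly" where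
  "Xvar i \<equiv> Var (Inr (Some i))"

abbreviation Xlast :: "('n, 'k::zero_neq_one) txpoly" where
  "Xlast \<equiv> Var (Inr None)"

definition bihomogeneous :: "nat \<Rightarrow> nat \<Rightarrow> ('n::finite, 'k::zero) txpoly \<Rightarrow> bool" where
  "bihomogeneous a b p \<longleftrightarrow>
     (\<forall>m\<in>Poly_Mapping.keys p.
        (\<Sum>i\<in>UNIV. Poly_Mapping.lookup m (Inl i)) = a \<and>
        (\<Sum>j\<in>UNIV. Poly_Mapping.lookup m (Inr j)) = b)"

text \<open>The inclusion of \<open>\<bbbK>[t]\<close> into \<open>\<bbbK>[t, X]\<close>.\<close>

definition tincl :: "('n::finite, 'k::field) mpoly \<Rightarrow> ('n, 'k) txpoly" where
  "tincl = msubst Const tvar"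

text \<open>The coordinates of the parametrization.\<close>

definition monoid_param ::
  "('n::finite, 'k::field) mpoly \<Rightarrow> ('n, 'k) mpoly \<Rightarrow> 'n option \<Rightarrow> ('n, 'k) mpoly" where
  "monoid_param fd1 fd j = (case j of Some i \<Rightarrow> Var i * fd1 | None \<Rightarrow> fd)"

text \<open>
  The target \<open>\<bbbK>[t][Z]\<close> consists of univariate polynomials over \<open>\<bbbK>[t]\<close>, so that
  \<open>monom q 1\<close> is \<open>q Z\<close>.
\<close>

definition rees_hom ::
  "('n::finite, 'k::field) mpoly \<Rightarrow> ('n, 'k) mpoly \<Rightarrow> ('n, 'k) txpoly \<Rightarrow> ('n, 'k) mpoly poly" where
  "rees_hom fd1 fd =
     msubst (\<lambda>c. [:Const c:])
       (\<lambda>v. case v of Inl i \<Rightarrow> [:Var i:] | Inr j \<Rightarrow> monom (monoid_param fd1 fd j) 1)"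

definition rees_kernel ::
  "('n::finite, 'k::field) mpoly \<Rightarrow> ('n, 'k) mpoly \<Rightarrow> ('n, 'k) txpoly set" where
  "rees_kernel fd1 fd = {p. rees_hom fd1 fd p = 0}"

definition pminor :: "'n \<Rightarrow> 'n \<Rightarrow> ('n, 'k::field) txpoly" where
  "pminor i j = tvar i * Xvar j - tvar j * Xvar i"

text \<open>
  \<open>F (d - 1), \<dots>, F 0\<close> arises from the recursive construction for some choice of the decompositions;
  the values of \<open>F\<close> from \<open>d\<close> on are irrelevant.
\<close>

definition F_start ::
  "nat \<Rightarrow> ('n::finite, 'k::field) mpoly \<Rightarrow> ('n, 'k) mpoly \<Rightarrow> ('n, 'k) txpoly \<Rightarrow> bool" where
  "F_start d fd1 fd q \<longleftrightarrow>
     (\<exists>g. (\<forall>j. homogeneous (d - 1) (g j)) \<and>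
          fd = (\<Sum>j\<in>UNIV. Var j * g j) \<and>
          q = tincl fd1 * Xlast - (\<Sum>j\<in>UNIV. tincl (g j) * Xvar j))"

definition F_step ::
  "nat \<Rightarrow> nat \<Rightarrow> ('n::finite, 'k::field) txpoly \<Rightarrow> ('n, 'k) txpoly \<Rightarrow> bool" where
  "F_step d j q q' \<longleftrightarrow>
     (\<exists>G. (\<forall>i. bihomogeneous (j - 1) (d - j) (G i)) \<and>
          q = (\<Sum>i\<in>UNIV. G i * tvar i) \<and>
          q' = (\<Sum>i\<in>UNIV. G i * Xvar i))"

definition F_sequence ::
  "nat \<Rightarrow> ('n::finite, 'k::field) mpoly \<Rightarrow> ('n, 'k) mpoly \<Rightarrow> (nat \<Rightarrow> ('n, 'k) txpoly) \<Rightarrow> bool" where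
  "F_sequence d fd1 fd F \<longleftrightarrow>
     F_start d fd1 fd (F (d - 1)) \<and> (\<forall>j\<in>{1..d - 1}. F_step d j (F j) (F (j - 1)))"

end

theory Submission
  imports Defs
begin

text \<open>
  Let \<open>\<psi>\<close> (\<open>segre_hom\<close>) send \<open>X\<^sub>i\<close> to \<open>t\<^sub>i W\<close> and \<open>X\<^sub>n\<^sub>+\<^sub>1\<close> to a new variable \<open>X\<close>. Its kernel is generated by
  the minors \<open>p\<^sub>i\<^sub>,\<^sub>j\<close>, and the morphism \<open>h\<close> is \<open>\<psi>\<close> followed by \<open>W \<mapsto> f\<^sub>d\<^sub>-\<^sub>1 Z\<close>, \<open>X \<mapsto> f\<^sub>d Z\<close>, whose kernel is
  the principal ideal of \<open>E = f\<^sub>d\<^sub>-\<^sub>1 X - f\<^sub>d W\<close> because \<open>f\<^sub>d\<^sub>-\<^sub>1\<close> and \<open>f\<^sub>d\<close> are coprime in the factorial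
  ring \<open>\<bbbK>[t]\<close>. The construction gives \<open>\<psi> F\<^sub>d\<^sub>-\<^sub>1\<^sub>-\<^sub>s = W\<^sup>s E\<close>. The image of \<open>\<psi>\<close> is spanned by the monomials
  \<open>t\<^sup>\<alpha> W\<^sup>k X\<^sup>l\<close> with \<open>k \<le> |\<alpha>|\<close>, and \<open>E\<close> is homogeneous of weight \<open>d - 1\<close> for the grading \<open>|\<alpha>| - k\<close>; hence
  \<open>E w\<close> lies in the image only if the monomials of \<open>w\<close> satisfy \<open>k \<le> |\<alpha>| + d - 1\<close>, and each of these
  is some \<open>W\<^sup>s\<close> with \<open>s \<le> d - 1\<close> times an element of the image.

  No \<open>F\<^sub>j\<close> is redundant because \<open>W\<^sup>s\<close> is not a combination of other powers of \<open>W\<close> with coefficients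
  in the image of \<open>\<psi>\<close>; no \<open>p\<^sub>i\<^sub>,\<^sub>j\<close> is redundant because a linear condition on the coefficients of low
  degree defines an ideal which contains all the other generators.
\<close>

section \<open>Factoriality of polynomial rings\<close>

locale ring_morphism =
  fixes h :: "'a::comm_ring_1 \<Rightarrow> 'b::comm_ring_1"
  assumes one [simp]: "h 1 = 1"
    and add: "h (x + y) = h x + h y"
    and mult: "h (x * y) = h x * h y"
begin

lemma zero [simp]: "h 0 = 0"
  using add[of 0 0] by simp

lemma uminus: "h (- x) = - h x"
  using add[of x "- x"] by (simp add: eq_neg_iff_add_eq_0 add.commute)

lemma diff: "h (x - y) = h x - h y"
  using add[of x "- y"] by (simp add: uminus)

lemma sum: "h (sum f S) = (\<Sum>i\<in>S. h (f i))"
  by (induction S rule: infinite_finite_induct) (simp_all add: add)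

lemma prod: "h (prod f S) = (\<Prod>i\<in>S. h (f i))"
  by (induction S rule: infinite_finite_induct) (simp_all add: mult)

lemma power: "h (x ^ n) = h x ^ n"
  by (induction n) (simp_all add: mult)

end

locale subdomain =
  fixes A :: "'a::idom set"
  assumes one_in [simp]: "1 \<in> A"
    and diff_in: "a \<in> A \<Longrightarrow> b \<in> A \<Longrightarrow> a - b \<in> A"
    and mult_in: "a \<in> A \<Longrightarrow> b \<in> A \<Longrightarrow> a * b \<in> A"
begin

lemma zero_in [simp]: "0 \<in> A"
  using diff_in[of 1 1] by simp

lemma uminus_in: "a \<in> A \<Longrightarrow> - a \<in> A"
  using diff_in[of 0 a] by simp

lemma add_in: "a \<in> A \<Longrightarrow> b \<in> A \<Longrightarrow> a + b \<in> A"
  using diff_in[of a "- b"] uminus_in[of b] by simp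

lemma sum_in: "(\<And>i. i \<in> I \<Longrightarrow> f i \<in> A) \<Longrightarrow> sum f I \<in> A"
  by (induction I rule: infinite_finite_induct) (simp_all add: add_in)

lemma prod_in: "(\<And>i. i \<in> I \<Longrightarrow> f i \<in> A) \<Longrightarrow> prod f I \<in> A"
  by (induction I rule: infinite_finite_induct) (simp_all add: mult_in)

lemma power_in: "a \<in> A \<Longrightarrow> a ^ n \<in> A"
  by (induction n) (simp_all add: mult_in)

end

text \<open>
  Divisibility and primality are taken relative to a subring \<open>A\<close> of a fixed domain: the polynomials
  in subsets of the variables are subrings of one type, which permits induction on the number of
  variables.
\<close>

definition dvd_in :: "'a::idom set \<Rightarrow> 'a \<Rightarrow> 'a \<Rightarrow> bool" where
  "dvd_in A a b \<longleftrightarrow> (\<exists>c\<in>A. b = a * c)"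

definition prime_in :: "'a::idom set \<Rightarrow> 'a \<Rightarrow> bool" where
  "prime_in A p \<longleftrightarrow> p \<in> A \<and> p \<noteq> 0 \<and> \<not> dvd_in A p 1 \<and>
     (\<forall>a\<in>A. \<forall>b\<in>A. dvd_in A p (a * b) \<longrightarrow> dvd_in A p a \<or> dvd_in A p b)"

inductive prime_product :: "'a::idom set \<Rightarrow> nat \<Rightarrow> 'a \<Rightarrow> bool" for A where
  unit: "u \<in> A \<Longrightarrow> dvd_in A u 1 \<Longrightarrow> prime_product A 0 u"
| mult: "prime_in A p \<Longrightarrow> prime_product A n q \<Longrightarrow> prime_product A (Suc n) (p * q)"

text \<open>A domain is factorial exactly when every nonzero element is a unit times a product of
  primes; uniqueness then comes for free. The number carried by \<open>prime_product\<close> counts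
  the prime factors and serves as an induction measure.\<close>

definition ufd_on :: "'a::idom set \<Rightarrow> bool" where
  "ufd_on A \<longleftrightarrow> (\<forall>a\<in>A. a \<noteq> 0 \<longrightarrow> (\<exists>n. prime_product A n a))"

definition poly_over :: "'a::zero set \<Rightarrow> 'a poly set" where
  "poly_over A = {p. \<forall>i. coeff p i \<in> A}"

section \<open>Prime factorizations relative to a subring\<close>

lemma prime_in_cases:
  assumes "prime_in A p" "dvd_in A p (a * b)" "a \<in> A" "b \<in> A"
  obtains c where "c \<in> A" "a = p * c" | c where "c \<in> A" "b = p * c"
  using assms unfolding prime_in_def dvd_in_def by blast

context subdomain
begin

lemma prime_product_in: "prime_product A n a \<Longrightarrow> a \<in> A"
  by (induction rule: prime_product.induct) (auto simp: prime_in_def mult_in)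

lemma prime_product_unit_mult:
  assumes "prime_product A n a" "u \<in> A" "dvd_in A u 1"
  shows "prime_product A n (u * a)"
  using assms
proof (induction rule: prime_product.induct)
  case (unit v)
  then obtain v' u' where inv: "v' \<in> A" "1 = v * v'" "u' \<in> A" "1 = u * u'"
    by (auto simp: dvd_in_def)
  have "1 = (u * u') * (v * v')" by (simp flip: inv(2,4))
  then have "1 = (u * v) * (u' * v')" by (simp only: ac_simps)
  then have "dvd_in A (u * v) 1" unfolding dvd_in_def using inv mult_in by blast
  then show ?case using unit by (intro prime_product.unit mult_in)
next
  case (mult p n q)
  then have "prime_product A n (u * q)" by blast
  with mult.hyps(1) have "prime_product A (Suc n) (p * (u * q))" by (rule prime_product.mult)
  then show ?case by (simp only: mult.left_commute)
qed

lemma prime_product_mult: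
  assumes "prime_product A n a" "prime_product A m b"
  shows "prime_product A (n + m) (a * b)"
  using assms
proof (induction rule: prime_product.induct)
  case (unit u) then show ?case by (simp add: prime_product_unit_mult)
next
  case (mult p n q)
  then have "prime_product A (n + m) (q * b)" by blast
  with mult.hyps(1) have "prime_product A (Suc (n + m)) (p * (q * b))" by (rule prime_product.mult)
  then show ?case by (simp only: mult.assoc add_Suc)
qed

text \<open>The prime \<open>p\<close> divides a factor of \<open>r * q\<close>: either it is
  associated to the split-off prime \<open>r\<close>, and then \<open>c\<close> is \<open>q\<close>
  up to a unit, or it divides \<open>q\<close> and the induction hypothesis applies. That exactly
  one prime factor is lost makes the extraction of contents terminate.\<close>

lemma prime_product_cancel:
  assumes "prime_product A n (p * c)" "prime_in A p" "c \<in> A"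
  shows "\<exists>m. n = Suc m \<and> prime_product A m c"
  using assms
proof (induction n "p * c" arbitrary: c rule: prime_product.induct)
  case unit
  then obtain v where v: "v \<in> A" "1 = p * c * v" unfolding dvd_in_def by blast
  from v(2) have "1 = p * (c * v)" by (simp only: mult.assoc)
  moreover have "c * v \<in> A" using v unit mult_in by blast
  ultimately have "dvd_in A p 1" unfolding dvd_in_def by blast
  then show ?case using unit.prems(1) unfolding prime_in_def by blast
next
  case (mult r n q)
  note eq = \<open>r * q = p * c\<close>
  have in_A: "r \<in> A" "q \<in> A" "p \<in> A" "r \<noteq> 0" "p \<noteq> 0"
    using mult.hyps(1,2) mult.prems(1) prime_product_in unfolding prime_in_def by blast+
  from eq have dvd: "dvd_in A p (r * q)" using \<open>c \<in> A\<close> by (auto simp: dvd_in_def)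
  from mult.prems(1) dvd in_A(1,2) show ?case
  proof (cases rule: prime_in_cases)
    case (1 v)
    note rpv = 1(2)
    \<comment> \<open>The prime \<open>r\<close> divides \<open>p * v\<close>, which is
      \<open>r\<close> itself. If it divides \<open>p\<close>, the cofactor \<open>v\<close> is a
      unit; if it divides \<open>v\<close>, then \<open>p\<close> would be a unit.\<close>
    have "dvd_in A r (p * v)" using 1 by (auto simp: dvd_in_def intro!: bexI[of _ 1])
    from mult.hyps(1) this in_A(3) 1(1) have "dvd_in A v 1"
    proof (cases rule: prime_in_cases)
      case (1 w)
      have "p * 1 = p * v * w" by (simp flip: rpv 1(2))
      then have "p * 1 = p * (v * w)" by (simp only: mult.assoc)
      then have "1 = v * w" using in_A(5) mult_left_cancel by blast
      with 1 show ?thesis unfolding dvd_in_def by blast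
    next
      case (2 w)
      have "v \<noteq> 0" using in_A(4) rpv by auto
      moreover have "v * 1 = p * v * w" by (simp flip: rpv 2(2))
      then have "v * 1 = v * (p * w)" by (simp only: ac_simps)
      ultimately have "1 = p * w" using mult_left_cancel by blast
      with 2 have "dvd_in A p 1" unfolding dvd_in_def by blast
      with mult.prems show ?thesis by (simp add: prime_in_def)
    qed
    moreover have "c = v * q"
      using eq in_A(5) unfolding rpv mult.assoc by simp
    ultimately show ?thesis using prime_product_unit_mult[OF mult.hyps(2) 1(1)] by blast
  next
    case (2 w)
    from mult.hyps(3)[OF 2(2) mult.prems(1) 2(1)] obtain m
      where m: "n = Suc m" "prime_product A m w" by blast
    have "p * (r * w) = p * c" using eq unfolding 2(2) by (simp only: mult.left_commute)
    then have "c = r * w" using in_A(5) by simp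
    with m mult.hyps(1) show ?thesis by (auto intro: prime_product.mult)
  qed
qed

section \<open>Contents and Gauss's lemma\<close>

lemma const_in_poly_over [simp]: "[:a:] \<in> poly_over A \<longleftrightarrow> a \<in> A"
  by (auto simp: poly_over_def coeff_pCons split: nat.splits)

lemma monom_in_poly_over: "a \<in> A \<Longrightarrow> monom a n \<in> poly_over A"
  by (auto simp: poly_over_def)

lemma coeff_in: "p \<in> poly_over A \<Longrightarrow> coeff p i \<in> A"
  by (simp add: poly_over_def)

lemma subdomain_poly_over: "subdomain (poly_over A)"
proof
  show "1 \<in> poly_over A" by (auto simp: poly_over_def coeff_1)
qed (auto simp: poly_over_def coeff_mult intro!: diff_in mult_in sum_in)

lemma dvd_in_const:
  "dvd_in (poly_over A) [:a:] p \<longleftrightarrow> (\<forall>i. dvd_in A a (coeff p i))"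
proof
  assume "dvd_in (poly_over A) [:a:] p"
  then show "\<forall>i. dvd_in A a (coeff p i)" by (auto simp: dvd_in_def poly_over_def)
next
  assume "\<forall>i. dvd_in A a (coeff p i)"
  then obtain c where c: "\<And>i. c i \<in> A" "\<And>i. coeff p i = a * c i"
    unfolding dvd_in_def by metis
  \<comment> \<open>The chosen quotients \<open>c i\<close> need not vanish beyond the degree when
    \<open>a = 0\<close>, so the sum is cut off there.\<close>
  define q where "q = (\<Sum>i\<le>degree p. monom (c i) i)"
  have q: "coeff q i = (if i \<le> degree p then c i else 0)" for i
    by (simp add: q_def coeff_sum if_distrib[of "\<lambda>x. coeff x i"] coeff_monom)
  have "p = [:a:] * q"
    by (rule poly_eqI) (simp add: q c(2)[symmetric] coeff_eq_0)
  moreover have "q \<in> poly_over A" using c by (auto simp: poly_over_def q)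
  ultimately show "dvd_in (poly_over A) [:a:] p" by (auto simp: dvd_in_def)
qed

lemma dvd_in_add: "dvd_in A a b \<Longrightarrow> dvd_in A a c \<Longrightarrow> dvd_in A a (b + c)"
  unfolding dvd_in_def by (metis add_in distrib_left)

lemma dvd_in_diff: "dvd_in A a b \<Longrightarrow> dvd_in A a c \<Longrightarrow> dvd_in A a (b - c)"
  unfolding dvd_in_def by (metis diff_in right_diff_distrib)

lemma dvd_in_mult: "dvd_in A a b \<Longrightarrow> c \<in> A \<Longrightarrow> dvd_in A a (b * c)"
  unfolding dvd_in_def by (metis mult_in mult.assoc)

lemma dvd_in_sum: "(\<And>i. i \<in> I \<Longrightarrow> dvd_in A a (f i)) \<Longrightarrow> dvd_in A a (sum f I)"
proof (induction I rule: infinite_finite_induct)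
qed (auto simp: dvd_in_add dvd_in_def[of A a 0] intro: bexI[of _ 0])

text \<open>Gauss's lemma: if \<open>i\<close> and \<open>j\<close> are the least indices of
  coefficients of \<open>f\<close> and \<open>g\<close> not divisible by \<open>p\<close>, then the
  coefficient of \<open>f * g\<close> at \<open>i + j\<close> is congruent to
  \<open>coeff f i * coeff g j\<close> modulo \<open>p\<close>, hence not divisible by
  \<open>p\<close>.\<close>

lemma prime_in_const:
  assumes "prime_in A p"
  shows "prime_in (poly_over A) [:p:]"
  unfolding prime_in_def
proof (intro conjI ballI impI)
  show "[:p:] \<in> poly_over A" "[:p:] \<noteq> 0" using assms by (auto simp: prime_in_def)
  show "\<not> dvd_in (poly_over A) [:p:] 1"
  proof
    assume "dvd_in (poly_over A) [:p:] 1"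
    then have "dvd_in A p (coeff 1 0)" using dvd_in_const by blast
    then show False using assms by (simp add: prime_in_def)
  qed
  fix f g assume f: "f \<in> poly_over A" and g: "g \<in> poly_over A"
    and dvd: "dvd_in (poly_over A) [:p:] (f * g)"
  show "dvd_in (poly_over A) [:p:] f \<or> dvd_in (poly_over A) [:p:] g"
  proof (rule ccontr)
    assume "\<not> ?thesis"
    then have ex: "\<exists>i. \<not> dvd_in A p (coeff f i)" "\<exists>i. \<not> dvd_in A p (coeff g i)"
      unfolding dvd_in_const by auto
    define i j where "i = (LEAST i. \<not> dvd_in A p (coeff f i))"
      and "j = (LEAST i. \<not> dvd_in A p (coeff g i))"
    have i: "\<not> dvd_in A p (coeff f i)" and j: "\<not> dvd_in A p (coeff g j)"
      unfolding i_def j_def by (rule LeastI_ex[OF ex(1)], rule LeastI_ex[OF ex(2)])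
    have i': "dvd_in A p (coeff f k)" if "k < i" for k
      using not_less_Least[of k "\<lambda>i. \<not> dvd_in A p (coeff f i)"] that i_def by blast
    have j': "dvd_in A p (coeff g k)" if "k < j" for k
      using not_less_Least[of k "\<lambda>i. \<not> dvd_in A p (coeff g i)"] that j_def by blast
    have rest: "dvd_in A p (\<Sum>k\<in>{..i+j}-{i}. coeff f k * coeff g (i + j - k))"
    proof (rule dvd_in_sum)
      fix k assume "k \<in> {..i + j} - {i}"
      then consider "k < i" | "i + j - k < j" by fastforce
      then show "dvd_in A p (coeff f k * coeff g (i + j - k))"
      proof cases
        case 1 then show ?thesis using i' g by (simp add: dvd_in_mult coeff_in)
      next
        case 2
        then have "dvd_in A p (coeff g (i + j - k) * coeff f k)"
          using j' f by (simp add: dvd_in_mult coeff_in)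
        then show ?thesis by (simp add: mult.commute)
      qed
    qed
    have "coeff (f * g) (i + j) =
        coeff f i * coeff g j + (\<Sum>k\<in>{..i+j}-{i}. coeff f k * coeff g (i + j - k))"
      by (simp add: coeff_mult sum.remove[of "{..i+j}" i])
    moreover have "dvd_in A p (coeff (f * g) (i + j))" using dvd dvd_in_const by blast
    ultimately have "dvd_in A p (coeff f i * coeff g j)"
      using dvd_in_diff[OF _ rest] by (metis add_diff_cancel_right')
    from prime_in_cases[OF assms this coeff_in[OF f] coeff_in[OF g]] show False
      using i j by (auto simp: dvd_in_def)
  qed
qed

lemma prime_product_const:
  assumes "prime_product A n a"
  shows "prime_product (poly_over A) n [:a:]"
  using assms
proof (induction rule: prime_product.induct)
  case (unit u)
  have "dvd_in A u (coeff 1 i)" for i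
    using unit by (cases i) (auto simp: dvd_in_def intro: bexI[of _ 0])
  then show ?case
    using unit by (intro prime_product.unit) (auto simp: dvd_in_const)
next
  case (mult p n q)
  have "prime_product (poly_over A) (Suc n) ([:p:] * [:q:])"
    using mult by (intro prime_product.mult prime_in_const)
  then show ?case by (simp add: mult.commute)
qed

text \<open>Every prime factor of \<open>e\<close> stays prime as a constant polynomial, so it
  divides \<open>p\<close> or \<open>q\<close> and can be cancelled there. This is how denominators
  are cleared without a field of fractions.\<close>

lemma const_factor_split:
  assumes "prime_product A n e" "[:e:] * r = p * q"
    "p \<in> poly_over A" "q \<in> poly_over A" "r \<in> poly_over A"
  shows "\<exists>e1\<in>A. \<exists>e2\<in>A. \<exists>p'\<in>poly_over A. \<exists>q'\<in>poly_over A.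
           p = [:e1:] * p' \<and> q = [:e2:] * q' \<and> r = p' * q'"
  using assms
proof (induction arbitrary: p q rule: prime_product.induct)
  case (unit u)
  interpret B: subdomain "poly_over A" by (rule subdomain_poly_over)
  from unit obtain v where v: "v \<in> A" "u * v = 1" by (auto simp: dvd_in_def)
  have u: "[:u:] * ([:v:] * s) = s" for s
  proof -
    have "[:u:] * [:v:] = 1" using v by (simp add: mult.commute)
    then show ?thesis by (simp only: mult_1 flip: mult.assoc)
  qed
  have "[:u:] * r = [:u:] * (([:v:] * p) * q)"
    unfolding unit.prems(1) u mult.assoc by (rule refl)
  moreover have "[:u:] \<noteq> 0" using v by auto
  ultimately have "r = ([:v:] * p) * q" using mult_left_cancel by blast
  moreover have "[:v:] * p \<in> poly_over A" using v unit by (intro B.mult_in) auto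
  ultimately show ?case using unit v u[of p]
    by (intro bexI[of _ u] bexI[of _ 1] bexI[of _ "[:v:] * p"] bexI[of _ q]) auto
next
  case (mult t n e)
  interpret B: subdomain "poly_over A" by (rule subdomain_poly_over)
  have t: "prime_in (poly_over A) [:t:]" "t \<in> A" "t \<noteq> 0" "e \<in> A"
    using mult prime_in_const prime_product_in by (auto simp: prime_in_def)
  have eq: "p * q = [:t:] * ([:e:] * r)"
    using mult.prems(1) by (simp add: mult.commute)
  have "[:e:] * r \<in> poly_over A" using t mult by (intro B.mult_in) auto
  then have "dvd_in (poly_over A) [:t:] (p * q)" using eq unfolding dvd_in_def by blast
  from t(1) this mult.prems(2,3) show ?case
  proof (cases rule: prime_in_cases)
    case (1 c)
    have "[:e:] * r = c * q"
      using eq t unfolding 1 by (metis mult.assoc mult_left_cancel pCons_eq_0_iff)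
    from mult.IH[OF this 1(1) mult.prems(3,4)] obtain e1 e2 p' q' where
      "e1 \<in> A" "e2 \<in> A" "p' \<in> poly_over A" "q' \<in> poly_over A"
      "c = [:e1:] * p'" "q = [:e2:] * q'" "r = p' * q'" by blast
    then show ?thesis using 1 t
      by (intro bexI[of _ "t * e1"] bexI[of _ e2] bexI[of _ p'] bexI[of _ q'])
        (auto simp: mult_in mult.commute)
  next
    case (2 c)
    have "[:e:] * r = p * c"
      using eq t unfolding 2 by (metis mult.left_commute mult_left_cancel pCons_eq_0_iff)
    from mult.IH[OF this mult.prems(2) 2(1) mult.prems(4)] obtain e1 e2 p' q' where
      "e1 \<in> A" "e2 \<in> A" "p' \<in> poly_over A" "q' \<in> poly_over A"
      "p = [:e1:] * p'" "c = [:e2:] * q'" "r = p' * q'" by blast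
    then show ?thesis using 2 t
      by (intro bexI[of _ e1] bexI[of _ "t * e2"] bexI[of _ p'] bexI[of _ q'])
        (auto simp: mult_in mult.commute)
  qed
qed

text \<open>Having trivial content is expressed through primes, so that no gcd of coefficients has
  to be formed.\<close>

definition primitive :: "'a poly \<Rightarrow> bool" where
  "primitive p \<longleftrightarrow> p \<in> poly_over A \<and> (\<forall>t. prime_in A t \<longrightarrow> \<not> dvd_in (poly_over A) [:t:] p)"

text \<open>Primes dividing all coefficients are pulled out one at a time; each of them uses up a
  prime factor of the leading coefficient, so the process stops.\<close>

lemma primitive_part:
  assumes "prime_product A n (lead_coeff p)" "p \<in> poly_over A"
  shows "\<exists>e\<in>A. \<exists>q. primitive q \<and> p = [:e:] * q"
  using assms
proof (induction n arbitrary: p rule: less_induct)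
  case (less n)
  show ?case
  proof (cases "primitive p")
    case True
    then show ?thesis by (intro bexI[of _ 1] exI[of _ p]) auto
  next
    case False
    then obtain t q where t: "prime_in A t" "q \<in> poly_over A" "p = [:t:] * q"
      using less.prems by (auto simp: primitive_def dvd_in_def)
    have "lead_coeff p = t * lead_coeff q" unfolding t by (simp add: lead_coeff_mult)
    then obtain m where m: "n = Suc m" "prime_product A m (lead_coeff q)"
      using prime_product_cancel[of n t "lead_coeff q"] less.prems t coeff_in by auto
    then obtain e r where "e \<in> A" "primitive r" "q = [:e:] * r"
      using less.IH[of m q] t by auto
    then show ?thesis using t
      by (intro bexI[of _ "t * e"] exI[of _ r]) (auto simp: prime_in_def mult_in mult.commute)
  qed
qed

text \<open>Distribute the prime factors of \<open>e\<close> over the two factors of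
  \<open>p * w = [:e:] * a\<close>. The share that falls to the primitive \<open>p\<close> must be a
  unit, so \<open>p\<close> still divides what remains.\<close>

lemma primitive_cancel_const:
  assumes "ufd_on A" "primitive p" "e \<in> A" "e \<noteq> 0" "a \<in> poly_over A"
    and "dvd_in (poly_over A) p ([:e:] * a)"
  shows "dvd_in (poly_over A) p a"
proof -
  interpret B: subdomain "poly_over A" by (rule subdomain_poly_over)
  obtain n where n: "prime_product A n e" using assms by (auto simp: ufd_on_def)
  obtain w where w: "[:e:] * a = p * w" "w \<in> poly_over A" using assms by (auto simp: dvd_in_def)
  have p: "p \<in> poly_over A" using assms by (simp add: primitive_def)
  from const_factor_split[OF n w(1) p w(2) assms(5)] obtain e1 e2 p' w' where
    *: "e1 \<in> A" "e2 \<in> A" "p' \<in> poly_over A" "w' \<in> poly_over A"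
      "p = [:e1:] * p'" "w = [:e2:] * w'" "a = p' * w'" by blast
  show ?thesis
  proof (cases "e1 = 0")
    \<comment> \<open>Here \<open>p = 0\<close>; the zero polynomial counts as primitive when
      \<open>A\<close> has no primes.\<close>
    case True
    then have "[:e:] * a = 0" using w * by simp
    then have "a = 0" using assms by simp
    then show ?thesis by (auto simp: dvd_in_def intro: bexI[of _ 0])
  next
    case False
    then obtain m where "prime_product A m e1" using assms * by (auto simp: ufd_on_def)
    then have "dvd_in A e1 1"
    proof cases
      case (mult t k q)
      then have "p = [:t:] * ([:q:] * p')" using * by (simp add: mult.commute)
      moreover have "[:q:] * p' \<in> poly_over A"
        using * mult prime_product_in by (intro B.mult_in) auto
      ultimately have "dvd_in (poly_over A) [:t:] p" unfolding dvd_in_def by blast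
      then show ?thesis using mult assms by (simp add: primitive_def)
    qed
    then obtain v where v: "v \<in> A" "e1 * v = 1" by (auto simp: dvd_in_def)
    then have e1v: "[:e1:] * [:v:] = 1" by (simp add: mult.commute)
    have "a = ([:e1:] * [:v:]) * (p' * w')" unfolding e1v *(7) by simp
    also have "\<dots> = p * ([:v:] * w')" unfolding *(5) by (simp only: ac_simps)
    finally have "a = p * ([:v:] * w')" .
    moreover have "[:v:] * w' \<in> poly_over A" using v * by (intro B.mult_in) auto
    ultimately show ?thesis unfolding dvd_in_def by blast
  qed
qed

text \<open>Division with remainder in an ideal \<open>M\<close>, after multiplying by leading
  coefficients of \<open>q\<close>: the remainder stays in \<open>M\<close> with smaller degree, and
  the minimality of \<open>degree q\<close> finally forces it to vanish.\<close>

lemma pseudo_multiple_of_minimal: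
  assumes M: "M \<subseteq> poly_over A"
    and M_diff: "\<And>f g. f \<in> M \<Longrightarrow> g \<in> M \<Longrightarrow> f - g \<in> M"
    and M_mult: "\<And>f g. f \<in> M \<Longrightarrow> g \<in> poly_over A \<Longrightarrow> g * f \<in> M"
    and q: "q \<in> M" "q \<noteq> 0" "\<And>f. f \<in> M \<Longrightarrow> f \<noteq> 0 \<Longrightarrow> degree q \<le> degree f"
    and f: "f \<in> M"
  shows "\<exists>e\<in>A. e \<noteq> 0 \<and> dvd_in (poly_over A) q ([:e:] * f)"
  using f
proof (induction "degree f" arbitrary: f rule: less_induct)
  case less
  interpret B: subdomain "poly_over A" by (rule subdomain_poly_over)
  show ?case
  proof (cases "f = 0")
    case True
    then show ?thesis by (intro bexI[of _ 1]) (auto simp: dvd_in_def intro: bexI[of _ 0])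
  next
    case False
    \<comment> \<open>Cross-multiplying by the leading coefficients cancels the top terms without a
      division in \<open>A\<close>.\<close>
    define c where "c = lead_coeff q"
    define g where "g = monom (lead_coeff f) (degree f - degree q)"
    define r where "r = [:c:] * f - g * q"
    have c: "c \<in> A" "c \<noteq> 0" using q M by (auto simp: c_def coeff_in)
    have g: "g \<in> poly_over A"
      unfolding g_def using less.prems M by (intro monom_in_poly_over coeff_in) blast
    have r: "r \<in> M" unfolding r_def using less c q g by (intro M_diff M_mult) auto
    have deg: "degree q \<le> degree f" using False q less by blast
    show ?thesis
    proof (cases "r = 0")
      case True
      then have "[:c:] * f = q * g" by (simp add: r_def mult.commute)
      then show ?thesis using c g by (auto simp: dvd_in_def intro!: bexI[of _ c])
    next
      case False
      have le: "degree r \<le> degree f"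
      proof -
        have "degree (g * q) \<le> degree f"
          using degree_mult_le[of g q] degree_monom_le[of "lead_coeff f" "degree f - degree q"] deg
          unfolding g_def by linarith
        moreover have "degree ([:c:] * f) \<le> degree f"
          by (simp add: degree_smult_le)
        ultimately show ?thesis unfolding r_def by (rule degree_diff_le[rotated])
      qed
      have "coeff (g * q) (degree f) = lead_coeff f * lead_coeff q"
        using deg by (simp add: g_def coeff_monom_mult)
      then have "coeff r (degree f) = 0" by (simp add: r_def c_def)
      with False le have "degree r < degree f"
        by (metis le_neq_implies_less leading_coeff_0_iff)
      from less.hyps[OF this r] obtain e s where e: "e \<in> A" "e \<noteq> 0"
        and s: "s \<in> poly_over A" "[:e:] * r = q * s" by (auto simp: dvd_in_def)
      have "[:e * c:] * f = [:e:] * r + [:e:] * (g * q)"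
        by (simp add: r_def algebra_simps)
      also have "\<dots> = q * (s + [:e:] * g)" by (simp only: s) (simp add: algebra_simps)
      finally have "dvd_in (poly_over A) q ([:e * c:] * f)"
        unfolding dvd_in_def using s e g B.add_in B.mult_in by (metis const_in_poly_over)
      then show ?thesis using e c by (intro bexI[of _ "e * c"]) (auto simp: mult_in)
    qed
  qed
qed

text \<open>Over the field of fractions this is the fact that irreducible elements of a principal
  ideal domain are prime. Fractions are replaced by nonzero constant multiples, which
  \<open>primitive_cancel_const\<close> removes at the end.\<close>

lemma prime_in_if_primitive_indecomposable:
  assumes ufd: "ufd_on A" and p: "primitive p" "degree p > 0"
    and indec: "\<And>q r. q \<in> poly_over A \<Longrightarrow> r \<in> poly_over A \<Longrightarrow> p = q * r \<Longrightarrow>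
      degree q = 0 \<or> degree r = 0"
  shows "prime_in (poly_over A) p"
  unfolding prime_in_def
proof (intro conjI ballI impI)
  interpret B: subdomain "poly_over A" by (rule subdomain_poly_over)
  show pB: "p \<in> poly_over A" and p0: "p \<noteq> 0" using p by (auto simp: primitive_def)
  show "\<not> dvd_in (poly_over A) p 1"
  proof
    assume "dvd_in (poly_over A) p 1"
    then obtain c where c: "1 = p * c" unfolding dvd_in_def by blast
    then have "c \<noteq> 0" by (metis mult_zero_right zero_neq_one)
    then have "degree (1 :: 'a poly) = degree p + degree c"
      unfolding c using p0 by (simp add: degree_mult_eq)
    then show False using p by simp
  qed
  fix a b assume a: "a \<in> poly_over A" and b: "b \<in> poly_over A"
    and ab: "dvd_in (poly_over A) p (a * b)"
  \<comment> \<open>An element \<open>q\<close> of least degree of the ideal \<open>M\<close> generated by \<open>a\<close> and \<open>p\<close> is, up to constants,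
    a gcd over the field of fractions; since \<open>p\<close> is indecomposable, \<open>q\<close> is associated to \<open>p\<close> or constant.\<close>
  define M where "M = {u * a + v * p | u v. u \<in> poly_over A \<and> v \<in> poly_over A}"
  have M: "M \<subseteq> poly_over A" using a pB by (auto simp: M_def intro!: B.add_in B.mult_in)
  have M_diff: "f - g \<in> M" if "f \<in> M" "g \<in> M" for f g
  proof -
    from that obtain u v u' v' where "u \<in> poly_over A" "v \<in> poly_over A" "u' \<in> poly_over A"
      "v' \<in> poly_over A" "f = u * a + v * p" "g = u' * a + v' * p" by (auto simp: M_def)
    then show ?thesis unfolding M_def
      by (intro CollectI exI[of _ "u - u'"] exI[of _ "v - v'"])
        (auto simp: algebra_simps B.diff_in)
  qed
  have M_mult: "g * f \<in> M" if "f \<in> M" "g \<in> poly_over A" for f g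
  proof -
    from that obtain u v where "u \<in> poly_over A" "v \<in> poly_over A" and f: "f = u * a + v * p"
      by (auto simp: M_def)
    moreover have "g * f = (g * u) * a + (g * v) * p"
      unfolding f by (simp only: distrib_left mult.assoc)
    ultimately show ?thesis unfolding M_def using that(2) B.mult_in by blast
  qed
  have aM: "a \<in> M" unfolding M_def using B.one_in B.zero_in
    by (intro CollectI exI[of _ 1] exI[of _ 0]) simp
  have pM: "p \<in> M" unfolding M_def using B.one_in B.zero_in
    by (intro CollectI exI[of _ 0] exI[of _ 1]) simp
  obtain q where q: "q \<in> M" "q \<noteq> 0" "\<And>f. f \<in> M \<Longrightarrow> f \<noteq> 0 \<Longrightarrow> degree q \<le> degree f"
    using ex_has_least_nat[of "\<lambda>f. f \<in> M \<and> f \<noteq> 0" p degree] pM p0 by blast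
  have qB: "q \<in> poly_over A" using q M by blast
  have pseudo: "\<exists>e\<in>A. e \<noteq> 0 \<and> dvd_in (poly_over A) q ([:e:] * f)" if "f \<in> M" for f
    by (rule pseudo_multiple_of_minimal[OF M _ _ q(1,2) _ that]) (use M_diff M_mult q(3) in auto)
  obtain e s where e: "e \<in> A" "e \<noteq> 0" and s: "s \<in> poly_over A" "[:e:] * p = q * s"
    using pseudo[OF pM] by (auto simp: dvd_in_def)
  \<comment> \<open>Splitting \<open>e\<close> turns the factorization of \<open>[:e:] * p\<close>
    into one of \<open>p\<close> itself inside \<open>poly_over A\<close>, to which
    indecomposability applies.\<close>
  obtain n where n: "prime_product A n e" using ufd e by (auto simp: ufd_on_def)
  from const_factor_split[OF n s(2) qB s(1) pB] obtain e1 e2 q' s' where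
    *: "e1 \<in> A" "e2 \<in> A" "q' \<in> poly_over A" "s' \<in> poly_over A"
      "q = [:e1:] * q'" "s = [:e2:] * s'" "p = q' * s'" by blast
  from indec[OF *(3,4,7)] show "dvd_in (poly_over A) p a \<or> dvd_in (poly_over A) p b"
  proof
    assume "degree s' = 0"
    then obtain c where c: "s' = [:c:]" using degree_eq_zeroE by blast
    have "c \<in> A" "c \<noteq> 0" using c * p0 by auto
    obtain e' w where e': "e' \<in> A" "e' \<noteq> 0" and w: "w \<in> poly_over A" "[:e':] * a = q * w"
      using pseudo[OF aM] by (auto simp: dvd_in_def)
    have "[:c * e':] * a = [:c:] * ([:e':] * a)" by (simp add: mult.commute)
    also have "\<dots> = [:c:] * (q * w)" by (simp only: w)
    also have "\<dots> = p * ([:e1:] * w)"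
      unfolding * c by (simp add: algebra_simps)
    finally have "dvd_in (poly_over A) p ([:c * e':] * a)"
      unfolding dvd_in_def using *(1) w B.mult_in by (metis const_in_poly_over)
    then show ?thesis
      using primitive_cancel_const[OF ufd p(1), of "c * e'" a] a e' \<open>c \<in> A\<close> \<open>c \<noteq> 0\<close>
      by (auto simp: mult_in)
  next
    assume "degree q' = 0"
    then obtain c where "q' = [:c:]" using degree_eq_zeroE by blast
    then have qc: "q = [:e1 * c:]" using * by simp
    have "e1 * c \<in> A" "e1 * c \<noteq> 0" using qc qB q by auto
    \<comment> \<open>A Bezout argument: the constant \<open>q = u * a + v * p\<close>, multiplied
      by \<open>b\<close>, becomes a multiple of \<open>p\<close> because \<open>p\<close> divides
      \<open>a * b\<close>.\<close>
    obtain u v where uv: "u \<in> poly_over A" "v \<in> poly_over A" "q = u * a + v * p"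
      using q by (auto simp: M_def)
    obtain w where w: "w \<in> poly_over A" "a * b = p * w" using ab by (auto simp: dvd_in_def)
    have "[:e1 * c:] * b = u * (a * b) + v * p * b"
      unfolding qc[symmetric] uv(3) by (simp only: distrib_right mult.assoc)
    also have "\<dots> = p * (u * w + v * b)"
      unfolding w(2) by (simp only: distrib_left ac_simps)
    finally have "[:e1 * c:] * b = p * (u * w + v * b)" .
    moreover have "u * w + v * b \<in> poly_over A"
      by (intro B.add_in B.mult_in uv(1,2) w(1) b)
    ultimately have "dvd_in (poly_over A) p ([:e1 * c:] * b)"
      unfolding dvd_in_def by blast
    then show ?thesis
      using primitive_cancel_const[OF ufd p(1), of "e1 * c" b] b \<open>e1 * c \<in> A\<close> \<open>e1 * c \<noteq> 0\<close>
      by auto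
  qed
qed

text \<open>Gauss's theorem, by induction on the degree. A polynomial that splits into factors of
  positive degree is handled by induction; otherwise it is a constant, factored in \<open>A\<close>,
  times a primitive polynomial, which is constant or indecomposable and then prime.\<close>

theorem ufd_on_poly_over:
  assumes ufd: "ufd_on A"
  shows "ufd_on (poly_over A)"
  unfolding ufd_on_def
proof (intro ballI impI)
  interpret B: subdomain "poly_over A" by (rule subdomain_poly_over)
  have const: "\<exists>n. prime_product (poly_over A) n [:a:]" if "a \<in> A" "a \<noteq> 0" for a
    using ufd that prime_product_const by (fastforce simp: ufd_on_def)
  fix p :: "'a poly" assume "p \<in> poly_over A" "p \<noteq> 0"
  then show "\<exists>n. prime_product (poly_over A) n p"
  proof (induction "degree p" arbitrary: p rule: less_induct)
    case less
    show ?case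
    proof (cases "\<exists>q\<in>poly_over A. \<exists>r\<in>poly_over A. p = q * r \<and> degree q > 0 \<and> degree r > 0")
      case True
      then obtain q r where qr: "q \<in> poly_over A" "r \<in> poly_over A" "p = q * r"
        "degree q > 0" "degree r > 0" by blast
      then have "q \<noteq> 0" "r \<noteq> 0" using less.prems by auto
      then have "degree q < degree p" "degree r < degree p"
        using qr by (simp_all add: degree_mult_eq)
      with less.hyps qr \<open>q \<noteq> 0\<close> \<open>r \<noteq> 0\<close> obtain n m where
        "prime_product (poly_over A) n q" "prime_product (poly_over A) m r" by metis
      then show ?thesis using B.prime_product_mult qr by blast
    next
      case False
      have "lead_coeff p \<in> A" "lead_coeff p \<noteq> 0" using less.prems by (auto simp: coeff_in)
      then obtain n where "prime_product A n (lead_coeff p)" using ufd by (auto simp: ufd_on_def)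
      from primitive_part[OF this less.prems(1)] obtain e q where
        e: "e \<in> A" and q: "primitive q" and pe: "p = [:e:] * q" by blast
      have "e \<noteq> 0" using pe less.prems by auto
      have qB: "q \<in> poly_over A" using q by (simp add: primitive_def)
      show ?thesis
      proof (cases "degree q = 0")
        case True
        then obtain c where "q = [:c:]" using degree_eq_zeroE by blast
        then have "p = [:e * c:]" using pe by simp
        then show ?thesis using const[of "e * c"] less.prems by simp
      next
        case deg: False
        have "prime_in (poly_over A) q"
        proof (rule prime_in_if_primitive_indecomposable[OF ufd q])
          show "0 < degree q" using deg by simp
          fix f g assume fg: "f \<in> poly_over A" "g \<in> poly_over A" "q = f * g"
          then have "p = ([:e:] * f) * g" using pe by (simp only: mult.assoc)
          moreover have "[:e:] * f \<in> poly_over A" using e fg by (intro B.mult_in) auto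
          moreover have "degree ([:e:] * f) = degree f" using \<open>e \<noteq> 0\<close> by simp
          ultimately show "degree f = 0 \<or> degree g = 0" using False fg by (metis gr0I)
        qed
        moreover have "prime_product (poly_over A) 0 1"
          by (rule prime_product.unit) (auto simp: dvd_in_def intro: bexI[of _ 1])
        ultimately have "prime_product (poly_over A) (Suc 0) (q * 1)"
          by (rule prime_product.mult)
        moreover obtain m where "prime_product (poly_over A) m [:e:]"
          using const e \<open>e \<noteq> 0\<close> by blast
        ultimately have "prime_product (poly_over A) (m + Suc 0) ([:e:] * (q * 1))"
          using B.prime_product_mult by blast
        then show ?thesis using pe by auto
      qed
    qed
  qed
qed

end

text \<open>Injectivity is asked only on \<open>B\<close>: the evaluation at a variable to which
  this is applied is injective only on polynomials whose coefficients avoid that variable.\<close>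

lemma ufd_on_image:
  fixes h :: "'a::idom \<Rightarrow> 'b::idom"
  assumes h: "ring_morphism h" and B: "subdomain B" and inj: "inj_on h B" and ufd: "ufd_on B"
  shows "ufd_on (h ` B)"
proof -
  interpret h: ring_morphism h by (rule h)
  interpret B: subdomain B by (rule B)
  have dvd: "dvd_in (h ` B) (h a) (h b) \<longleftrightarrow> dvd_in B a b" if "a \<in> B" "b \<in> B" for a b
  proof
    assume "dvd_in (h ` B) (h a) (h b)"
    then obtain c where "c \<in> B" "h b = h (a * c)" by (auto simp: dvd_in_def h.mult)
    then have "b = a * c" using inj that B.mult_in by (auto dest: inj_onD)
    then show "dvd_in B a b" using \<open>c \<in> B\<close> by (auto simp: dvd_in_def)
  qed (auto simp: dvd_in_def h.mult)
  have prime: "prime_in (h ` B) (h p)" if p: "prime_in B p" for p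
    unfolding prime_in_def
  proof (intro conjI ballI impI)
    have pB: "p \<in> B" "p \<noteq> 0" using p by (auto simp: prime_in_def)
    then show "h p \<in> h ` B" "h p \<noteq> 0" using inj_onD[OF inj, of p 0] by auto
    show "\<not> dvd_in (h ` B) (h p) 1"
      using dvd[of p 1] p by (simp add: prime_in_def)
    fix a b assume "a \<in> h ` B" "b \<in> h ` B" and d: "dvd_in (h ` B) (h p) (a * b)"
    then obtain x y where xy: "x \<in> B" "y \<in> B" "a = h x" "b = h y" by blast
    then have "dvd_in (h ` B) (h p) (h (x * y))" using d by (simp add: h.mult)
    then have "dvd_in B p (x * y)" using dvd pB xy B.mult_in by blast
    then show "dvd_in (h ` B) (h p) a \<or> dvd_in (h ` B) (h p) b"
      using p xy dvd pB by (auto simp: prime_in_def)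
  qed
  have "prime_product (h ` B) n (h a)" if "prime_product B n a" for n a
    using that
  proof (induction rule: prime_product.induct)
    case (unit u)
    then show ?case using dvd[of u 1] by (intro prime_product.unit) auto
  next
    case (mult p n q)
    then show ?case by (auto simp: h.mult intro: prime_product.mult prime)
  qed
  then show ?thesis using ufd unfolding ufd_on_def by fastforce
qed

text \<open>The prime factors of \<open>f\<close> are cancelled one by one: each divides
  \<open>c * g\<close> but not \<open>g\<close>, hence it divides \<open>c\<close>.\<close>

lemma dvd_cancel_if_no_common_factor:
  fixes f g c :: "'a::idom"
  assumes "ufd_on (UNIV :: 'a set)" "no_common_factor f g" "f \<noteq> 0" "f dvd c * g"
  shows "f dvd c"
proof -
  obtain n where "prime_product UNIV n f" using assms by (auto simp: ufd_on_def)
  then show ?thesis using assms(2,4)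
  proof (induction arbitrary: c rule: prime_product.induct)
    case (unit u)
    then have "u dvd 1" unfolding dvd_in_def dvd_def by blast
    then show ?case by (meson dvd_trans one_dvd)
  next
    case (mult p n q)
    have dvd: "dvd_in UNIV a b \<longleftrightarrow> a dvd b" for a b :: 'a by (auto simp: dvd_in_def dvd_def)
    have "p dvd c * g" using mult.prems dvd_mult_left by blast
    moreover have "\<not> p dvd g"
      using mult unfolding no_common_factor_def by (auto simp: prime_in_def dvd)
    ultimately have "p dvd c" using mult.hyps by (auto simp: prime_in_def dvd)
    then obtain c' where c': "c = p * c'" ..
    have "p \<noteq> 0" using mult.hyps by (simp add: prime_in_def)
    moreover have "p * q dvd p * (c' * g)" using mult.prems(2) unfolding c' mult.assoc .
    ultimately have "q dvd c' * g" by simp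
    moreover have "no_common_factor q g"
      using mult.prems(1) dvd_mult[of _ q p] unfolding no_common_factor_def by blast
    ultimately have "q dvd c'" by (rule mult.IH[rotated])
    then show ?case unfolding c' by (rule mult_dvd_mono[OF dvd_refl])
  qed
qed

section \<open>Substitution morphisms on multivariate polynomials\<close>

lemma mpoly_sum_singles:
  "p = (\<Sum>m\<in>Poly_Mapping.keys p. Poly_Mapping.single m (Poly_Mapping.lookup p m))"
  by (rule poly_mapping_eqI)
    (simp add: lookup_sum lookup_single when_def sum.delta' in_keys_iff)

lemma mpoly_induct [case_names single add]:
  fixes p :: "'m \<Rightarrow>\<^sub>0 'k::comm_monoid_add"
  assumes "\<And>m c. P (Poly_Mapping.single m c)" "\<And>p q. P p \<Longrightarrow> P q \<Longrightarrow> P (p + q)"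
  shows "P p"
proof -
  have "P (\<Sum>m\<in>S. Poly_Mapping.single m (f m))" for S f
    \<comment> \<open>The empty sum is covered as a single term with coefficient zero.\<close>
    using assms(1)[of undefined 0]
    by (induction S rule: infinite_finite_induct) (auto intro: assms)
  then show ?thesis by (subst mpoly_sum_singles)
qed

text \<open>Enlarging the index set lets the values of \<open>p\<close>, \<open>q\<close> and
  \<open>p + q\<close> be compared as sums over the same exponents.\<close>

lemma msubst_superset:
  assumes "ring_morphism c" "finite S" "Poly_Mapping.keys p \<subseteq> S"
  shows "msubst c s p =
    (\<Sum>m\<in>S. c (Poly_Mapping.lookup p m) * (\<Prod>v\<in>UNIV. s v ^ Poly_Mapping.lookup m v))"
  unfolding msubst_def using assms
  by (intro sum.mono_neutral_left) (auto simp: in_keys_iff ring_morphism.zero)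

lemma msubst_single:
  assumes "ring_morphism c"
  shows "msubst c s (Poly_Mapping.single m a) = c a * (\<Prod>v\<in>UNIV. s v ^ Poly_Mapping.lookup m v)"
  using msubst_superset[OF assms, of "{m}" "Poly_Mapping.single m a"] by (auto split: if_splits)

lemma msubst_add:
  assumes "ring_morphism c"
  shows "msubst c s (p + q) = msubst c s p + msubst c s q"
proof -
  interpret c: ring_morphism c by (rule assms)
  let ?S = "Poly_Mapping.keys p \<union> Poly_Mapping.keys q"
  show ?thesis using keys_add[of p q]
    by (simp add: msubst_superset[OF assms, of ?S] lookup_add c.add distrib_right sum.distrib)
qed

text \<open>The product rule is additive in both arguments, so it suffices to check it on two single
  terms.\<close>

lemma ring_morphism_msubst:
  assumes "ring_morphism c"
  shows "ring_morphism (msubst c s)"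
proof
  interpret c: ring_morphism c by (rule assms)
  show "msubst c s 1 = 1"
    unfolding single_one[symmetric] msubst_single[OF assms] by simp
  show add: "msubst c s (p + q) = msubst c s p + msubst c s q" for p q
    by (rule msubst_add[OF assms])
  show "msubst c s (p * q) = msubst c s p * msubst c s q" for p q
  proof (induction p rule: mpoly_induct)
    case (single m a)
    show ?case
    proof (induction q rule: mpoly_induct)
      case (single n b)
      show ?case
        unfolding mult_single msubst_single[OF assms] c.mult lookup_add power_add prod.distrib
        by (simp only: ac_simps)
    qed (simp add: distrib_left add)
  qed (simp add: distrib_right add)
qed

lemma ring_morphism_comp:
  "ring_morphism g \<Longrightarrow> ring_morphism f \<Longrightarrow> ring_morphism (\<lambda>x. g (f x))"
  by (auto simp: ring_morphism_def)

lemma ring_morphism_Const: "ring_morphism (Const :: 'k::comm_ring_1 \<Rightarrow> ('v, 'k) mpoly)"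
  by unfold_locales (simp_all add: Const_def single_add mult_single)

lemma ring_morphism_const_poly: "ring_morphism (\<lambda>c. [:c:])"
  by unfold_locales (simp_all add: one_pCons mult.commute)

lemma ring_morphism_poly: "ring_morphism (\<lambda>p. poly p x)"
  by unfold_locales simp_all

lemma msubst_Const: "ring_morphism c \<Longrightarrow> msubst c s (Const a) = c a"
  by (simp add: Const_def msubst_single)

lemma msubst_Var:
  assumes "ring_morphism c"
  shows "msubst c s (Var v) = s v"
proof -
  interpret c: ring_morphism c by (rule assms)
  have "(\<Prod>w\<in>UNIV. s w ^ Poly_Mapping.lookup (Poly_Mapping.single v (1::nat)) w)
      = (\<Prod>w\<in>UNIV. if w = v then s w else 1)"
    by (rule prod.cong) (auto simp: lookup_single)
  then show ?thesis by (simp add: Var_def msubst_single[OF assms] prod.delta)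
qed

text \<open>Reduces identities between composite morphisms to their values on constants and
  variables.\<close>

lemma morphism_msubst:
  assumes "ring_morphism h"
  shows "h (msubst c s p) = msubst (\<lambda>a. h (c a)) (\<lambda>v. h (s v)) p"
proof -
  interpret h: ring_morphism h by (rule assms)
  show ?thesis by (simp add: msubst_def h.sum h.mult h.prod h.power)
qed

lemma Var_power: "(Var v :: ('v, 'k::comm_ring_1) mpoly) ^ n
    = Poly_Mapping.single (Poly_Mapping.single v n) 1"
  by (induction n) (simp_all add: Var_def mult_single flip: single_add)

lemma prod_single_one:
  "(\<Prod>i\<in>I. Poly_Mapping.single (f i) (1::'k::comm_ring_1))
     = Poly_Mapping.single (\<Sum>i\<in>I. f i :: 'm::comm_monoid_add) 1"
  by (induction I rule: infinite_finite_induct) (simp_all add: mult_single)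

lemma exponent_sum_singles:
  "(\<Sum>v\<in>UNIV. Poly_Mapping.single v (Poly_Mapping.lookup m v)) = (m :: 'v::finite \<Rightarrow>\<^sub>0 nat)"
  by (rule poly_mapping_eqI) (simp add: lookup_sum lookup_single when_def sum.delta')

lemma prod_Var_power:
  "(\<Prod>v\<in>UNIV. (Var (f v) :: ('w, 'k::comm_ring_1) mpoly) ^ a v)
     = Poly_Mapping.single (\<Sum>v\<in>UNIV. Poly_Mapping.single (f v) (a v)) 1"
  by (simp add: Var_power prod_single_one)

lemma single_eq_Const_mult:
  "Poly_Mapping.single m c = Const c * Poly_Mapping.single m (1::'k::comm_ring_1)"
  by (simp add: Const_def mult_single)

lemma msubst_Const_Var [simp]: "msubst Const Var p = (p :: ('v::finite, 'k::comm_ring_1) mpoly)"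
proof (induction p rule: mpoly_induct)
  case (single m c)
  show ?case
    unfolding msubst_single[OF ring_morphism_Const] prod_Var_power exponent_sum_singles
    by (rule single_eq_Const_mult[symmetric])
qed (simp add: msubst_add[OF ring_morphism_Const])

section \<open>Factoriality by adjoining one variable at a time\<close>

definition polys_in :: "'v set \<Rightarrow> ('v, 'k::zero) mpoly set" where
  "polys_in S = {p. \<forall>m\<in>Poly_Mapping.keys p. Poly_Mapping.keys m \<subseteq> S}"

lemma subdomain_polys_in:
  "subdomain (polys_in S :: ('v::linorder, 'k::idom) mpoly set)"
proof
  show "1 \<in> (polys_in S :: ('v::linorder, 'k::idom) mpoly set)" by (simp add: polys_in_def)
  fix p q :: "('v, 'k) mpoly" assume p: "p \<in> polys_in S" and q: "q \<in> polys_in S"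
  show "p - q \<in> polys_in S"
    unfolding polys_in_def
  proof (intro CollectI ballI)
    fix m assume "m \<in> Poly_Mapping.keys (p - q)"
    then have "m \<in> Poly_Mapping.keys p \<or> m \<in> Poly_Mapping.keys q"
      by (auto simp: in_keys_iff lookup_minus)
    then show "Poly_Mapping.keys m \<subseteq> S" using p q unfolding polys_in_def by blast
  qed
  show "p * q \<in> polys_in S"
    unfolding polys_in_def
  proof (intro CollectI ballI)
    fix m assume "m \<in> Poly_Mapping.keys (p * q)"
    then obtain a b where "m = a + b" "a \<in> Poly_Mapping.keys p" "b \<in> Poly_Mapping.keys q"
      using keys_mult by blast
    then show "Poly_Mapping.keys m \<subseteq> S"
      using p q keys_add[of a b] unfolding polys_in_def by blast
  qed
qed

lemma Const_in_polys_in: "Const c \<in> polys_in S"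
  by (simp add: Const_def polys_in_def)

lemma Var_in_polys_in: "v \<in> S \<Longrightarrow> Var v \<in> polys_in S"
  by (simp add: Var_def polys_in_def)

text \<open>Without variables, nonzero polynomials are units. Adjoining \<open>x\<close> amounts to
  passing to univariate polynomials over \<open>polys_in S\<close>: \<open>eval\<close> substitutes
  \<open>x\<close>, and \<open>expand\<close> inverts it by collecting powers of \<open>x\<close>,
  so Gauss's theorem carries over.\<close>

lemma ufd_on_polys_in:
  assumes "finite S"
  shows "ufd_on (polys_in S :: ('v::{finite,linorder}, 'k::field) mpoly set)"
  using assms
proof (induction S rule: finite_induct)
  case empty
  show ?case
    unfolding ufd_on_def
  proof (intro ballI impI)
    fix p :: "('v, 'k) mpoly" assume p: "p \<in> polys_in {}" "p \<noteq> 0"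
    then have keys: "Poly_Mapping.keys p \<subseteq> {0}" by (auto simp: polys_in_def)
    define c where "c = Poly_Mapping.lookup p 0"
    have eq: "p = Const c" using keys
      by (intro poly_mapping_eqI) (auto simp: c_def Const_def lookup_single in_keys_iff when_def)
    then have "c \<noteq> 0" using p by (auto simp: Const_def)
    then have "1 = p * Const (inverse c)" by (simp add: eq Const_def mult_single)
    then have "dvd_in (polys_in {}) p 1"
      using Const_in_polys_in unfolding dvd_in_def by blast
    then show "\<exists>n. prime_product (polys_in {}) n p" using p prime_product.unit by blast
  qed
next
  case (insert x S)
  interpret S: subdomain "polys_in S :: ('v, 'k) mpoly set" by (rule subdomain_polys_in)
  interpret B: subdomain "poly_over (polys_in S) :: ('v, 'k) mpoly poly set"
    by (rule S.subdomain_poly_over)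
  interpret I: subdomain "polys_in (insert x S) :: ('v, 'k) mpoly set" by (rule subdomain_polys_in)
  define eval :: "('v, 'k) mpoly poly \<Rightarrow> ('v, 'k) mpoly" where "eval P = poly P (Var x)" for P
  define s :: "'v \<Rightarrow> ('v, 'k) mpoly poly" where
    "s v = (if v = x then [:0, 1:] else [:Var v:])" for v
  define expand where "expand = msubst (\<lambda>c::'k. [:Const c :: ('v, 'k) mpoly:]) s"
  have cm: "ring_morphism (\<lambda>c::'k. [:Const c :: ('v, 'k) mpoly:])"
    using ring_morphism_comp[OF ring_morphism_const_poly ring_morphism_Const] .
  interpret expand: ring_morphism expand
    unfolding expand_def by (rule ring_morphism_msubst[OF cm])
  have eval: "ring_morphism eval" unfolding eval_def by (rule ring_morphism_poly)
  have const: "expand p = [:p:]" if "p \<in> polys_in S" for p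
  proof -
    have "expand p = msubst (\<lambda>c. [:Const c:]) (\<lambda>v. [:Var v:]) p"
      unfolding expand_def msubst_def
    proof (intro sum.cong prod.cong refl arg_cong2[of _ _ _ _ "(*)"])
      fix m v assume "m \<in> Poly_Mapping.keys p"
      then have "x \<notin> Poly_Mapping.keys m" using that insert by (auto simp: polys_in_def)
      then show "s v ^ Poly_Mapping.lookup m v = [:Var v:] ^ Poly_Mapping.lookup m v"
        by (auto simp: s_def in_keys_iff)
    qed
    also have "\<dots> = [:msubst Const Var p:]"
      by (rule morphism_msubst[OF ring_morphism_const_poly, symmetric])
    finally show ?thesis by simp
  qed
  have expand_eval: "expand (eval P) = P" if "P \<in> poly_over (polys_in S)" for P
  proof -
    have "expand (Var x) = [:0, 1:]" unfolding expand_def msubst_Var[OF cm] by (simp add: s_def)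
    moreover have "expand (coeff P i) = [:coeff P i:]" for i
      using that const by (simp add: poly_over_def)
    ultimately have "expand (eval P) = (\<Sum>i\<le>degree P. [:coeff P i:] * [:0, 1:] ^ i)"
      by (simp add: eval_def poly_altdef expand.sum expand.mult expand.power)
    also have "\<dots> = (\<Sum>i\<le>degree P. monom (coeff P i) i)" by (simp add: monom_altdef)
    finally show ?thesis by (simp add: poly_as_sum_of_monoms)
  qed
  have eval_expand: "eval (expand p) = p" for p
  proof -
    have "eval (expand p) = msubst Const (\<lambda>v. eval (s v)) p"
      unfolding expand_def morphism_msubst[OF eval] by (simp add: eval_def)
    also have "(\<lambda>v. eval (s v)) = Var" by (auto simp: eval_def s_def)
    finally show ?thesis by simp
  qed
  have image: "eval ` poly_over (polys_in S) = polys_in (insert x S)"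
  proof (intro equalityI subsetI)
    fix p assume "p \<in> eval ` poly_over (polys_in S)"
    then obtain P where P: "P \<in> poly_over (polys_in S)" "p = eval P" by blast
    have "coeff P i \<in> polys_in (insert x S)" for i
      using P by (auto simp: poly_over_def polys_in_def)
    then show "p \<in> polys_in (insert x S)"
      unfolding P eval_def poly_altdef
      by (intro I.sum_in I.mult_in I.power_in Var_in_polys_in) auto
  next
    fix p :: "('v, 'k) mpoly" assume p: "p \<in> polys_in (insert x S)"
    have "s v ^ Poly_Mapping.lookup m v \<in> poly_over (polys_in S)"
      if "m \<in> Poly_Mapping.keys p" for m v
    proof (cases "v \<in> insert x S")
      case True
      then have "s v \<in> poly_over (polys_in S)"
        by (auto simp: s_def Var_in_polys_in poly_over_def coeff_pCons split: nat.splits)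
      then show ?thesis by (rule B.power_in)
    next
      case False
      then have "v \<notin> Poly_Mapping.keys m" using p that by (auto simp: polys_in_def)
      then show ?thesis by (simp add: in_keys_iff)
    qed
    then have "expand p \<in> poly_over (polys_in S)"
      unfolding expand_def msubst_def
      by (intro B.sum_in B.mult_in B.prod_in) (simp_all add: Const_in_polys_in)
    then show "p \<in> eval ` poly_over (polys_in S)" using eval_expand[of p] by (metis imageI)
  qed
  have inj: "inj_on eval (poly_over (polys_in S))"
    by (rule inj_on_inverseI[of _ expand]) (rule expand_eval)
  show ?case
    using ufd_on_image[OF eval B.subdomain_axioms inj S.ufd_on_poly_over[OF insert.IH]]
    unfolding image .
qed

lemma dvd_cancel_mpoly:
  fixes f g c :: "('v::{finite,linorder}, 'k::field) mpoly"
  assumes "no_common_factor f g" "f \<noteq> 0" "f dvd c * g"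
  shows "f dvd c"
proof -
  have "polys_in UNIV = (UNIV :: ('v, 'k) mpoly set)" by (auto simp: polys_in_def)
  moreover have "ufd_on (polys_in UNIV :: ('v, 'k) mpoly set)" by (rule ufd_on_polys_in) simp
  ultimately have "ufd_on (UNIV :: ('v, 'k) mpoly set)" by simp
  then show ?thesis using assms by (rule dvd_cancel_if_no_common_factor)
qed

section \<open>The kernel of the Segre homomorphism\<close>

definition segre_hom ::
  "('n::finite, 'k::comm_ring_1) txpoly \<Rightarrow> ('n, 'k) mpoly poly poly" where
  "segre_hom = msubst (\<lambda>c. [:[:Const c:]:])
     (\<lambda>v. case v of Inl i \<Rightarrow> [:[:Var i:]:]
        | Inr None \<Rightarrow> monom 1 1 | Inr (Some i) \<Rightarrow> [:monom (Var i) 1:])"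

section \<open>Images of monomials\<close>

text \<open>
  In \<open>('n, 'k) mpoly poly poly\<close> the inner polynomial variable is \<open>W\<close> and the outer one is \<open>X\<close>.
\<close>

lemma ring_morphism_const_const: "ring_morphism (\<lambda>c. [:[:c:]:])"
  by (rule ring_morphism_comp[OF ring_morphism_const_poly ring_morphism_const_poly])

lemma ring_morphism_const_const_Const: "ring_morphism (\<lambda>c::'k::comm_ring_1. [:[:Const c:]:])"
  by (rule ring_morphism_comp[OF ring_morphism_const_const ring_morphism_Const])

interpretation segre: ring_morphism
  "segre_hom :: ('n::finite, 'k::comm_ring_1) txpoly \<Rightarrow> ('n, 'k) mpoly poly poly"
  unfolding segre_hom_def by (rule ring_morphism_msubst[OF ring_morphism_const_const_Const])

lemma segre_hom_Const: "segre_hom (Const c) = [:[:Const c:]:]"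
  unfolding segre_hom_def by (rule msubst_Const[OF ring_morphism_const_const_Const])

lemma segre_hom_Var:
  "segre_hom (tvar i) = [:[:Var i:]:]"
  "segre_hom (Xvar i) = [:monom (Var i) 1:]"
  "segre_hom Xlast = monom 1 1"
  unfolding segre_hom_def msubst_Var[OF ring_morphism_const_const_Const] by simp_all

lemma segre_hom_tincl:
  fixes p :: "('n::finite, 'k::field) mpoly"
  shows "segre_hom (tincl p) = [:[:p:]:]"
proof -
  have "segre_hom (tincl p) = msubst (\<lambda>a. [:[:Const a:]:]) (\<lambda>v. [:[:Var v:]:]) p"
    unfolding tincl_def morphism_msubst[OF segre.ring_morphism_axioms]
      segre_hom_Const segre_hom_Var ..
  also have "\<dots> = [:[:msubst Const Var p:]:]"
    by (rule morphism_msubst[OF ring_morphism_const_const, symmetric])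
  finally show ?thesis by simp
qed

text \<open>As \<open>X\<^sub>i\<close> goes to \<open>t\<^sub>i W\<close>, the exponents of
  \<open>t\<^sub>i\<close> and \<open>X\<^sub>i\<close> add up in the image of a monomial
  \<open>m\<close>. This image has exponent \<open>tx_exponent m\<close> in the
  \<open>t\<^sub>i\<close>, \<open>x_degree m\<close> in \<open>W\<close>, and in \<open>X\<close>
  the exponent of the last variable in \<open>m\<close>.\<close>

definition tx_exponent :: "('n::finite + 'n option \<Rightarrow>\<^sub>0 nat) \<Rightarrow> 'n \<Rightarrow>\<^sub>0 nat" where
  "tx_exponent m = (\<Sum>i\<in>UNIV. Poly_Mapping.single i
     (Poly_Mapping.lookup m (Inl i) + Poly_Mapping.lookup m (Inr (Some i))))"

definition x_degree :: "('n::finite + 'n option \<Rightarrow>\<^sub>0 nat) \<Rightarrow> nat" where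
  "x_degree m = (\<Sum>i\<in>UNIV. Poly_Mapping.lookup m (Inr (Some i)))"

lemma lookup_tx_exponent:
  "Poly_Mapping.lookup (tx_exponent m) i =
     Poly_Mapping.lookup m (Inl i) + Poly_Mapping.lookup m (Inr (Some i))"
  by (simp add: tx_exponent_def lookup_sum lookup_single when_def sum.delta')

lemma tx_exponent_add: "tx_exponent (a + b) = tx_exponent a + tx_exponent b"
  by (rule poly_mapping_eqI) (simp add: lookup_tx_exponent lookup_add)

lemma tx_exponent_single:
  "tx_exponent (Poly_Mapping.single (Inl i) 1) = Poly_Mapping.single i 1"
  "tx_exponent (Poly_Mapping.single (Inr (Some i)) 1) = Poly_Mapping.single i 1"
  by (rule poly_mapping_eqI; simp add: lookup_tx_exponent lookup_single when_def)+

lemma x_degree_add: "x_degree (a + b) = x_degree a + x_degree b"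
  by (simp add: x_degree_def lookup_add sum.distrib)

lemma x_degree_single:
  "x_degree (Poly_Mapping.single (Inl i) 1) = 0"
  "x_degree (Poly_Mapping.single (Inr (Some i)) 1) = 1"
  by (simp_all add: x_degree_def lookup_single when_def sum.delta')

lemma prod_UNIV_sum_option:
  fixes f :: "'n::finite + 'n option \<Rightarrow> 'a::comm_monoid_mult"
  shows "prod f UNIV = (\<Prod>i\<in>UNIV. f (Inl i)) * ((\<Prod>i\<in>UNIV. f (Inr (Some i))) * f (Inr None))"
  by (subst UNIV_Plus_UNIV[symmetric])
    (simp add: prod.Plus UNIV_option_conv prod.reindex mult.commute comp_def)

lemma prod_monom: "(\<Prod>i\<in>I. monom (a i) (n i)) = monom (\<Prod>i\<in>I. a i) (\<Sum>i\<in>I. n i)"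
  by (induction I rule: infinite_finite_induct) (simp_all add: mult_monom)

lemma segre_hom_single:
  "segre_hom (Poly_Mapping.single m c) =
     monom (monom (Poly_Mapping.single (tx_exponent m) c) (x_degree m))
       (Poly_Mapping.lookup m (Inr None))"
proof -
  interpret cc: ring_morphism "\<lambda>c::('a, 'b) mpoly. [:[:c:]:]" by (rule ring_morphism_const_const)
  interpret c: ring_morphism "\<lambda>c::('a, 'b) mpoly poly. [:c:]" by (rule ring_morphism_const_poly)
  define \<alpha> where "\<alpha> = (\<Sum>i\<in>UNIV. Poly_Mapping.single i (Poly_Mapping.lookup m (Inl i)))"
  define \<beta> where "\<beta> = (\<Sum>i\<in>UNIV. Poly_Mapping.single i (Poly_Mapping.lookup m (Inr (Some i))))"
  have tx: "tx_exponent m = \<alpha> + \<beta>"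
    by (simp add: tx_exponent_def \<alpha>_def \<beta>_def single_add sum.distrib)
  have t: "(\<Prod>i\<in>UNIV. [:[:Var i:]:] ^ Poly_Mapping.lookup m (Inl i))
      = [:[:Poly_Mapping.single \<alpha> (1::'b):]:]"
    unfolding cc.power[symmetric] cc.prod[symmetric] prod_Var_power \<alpha>_def ..
  have x: "(\<Prod>i\<in>UNIV. [:monom (Var i) 1:] ^ Poly_Mapping.lookup m (Inr (Some i)))
      = [:monom (Poly_Mapping.single \<beta> (1::'b)) (x_degree m):]"
    unfolding c.power[symmetric] c.prod[symmetric] monom_power prod_monom prod_Var_power \<beta>_def
      x_degree_def by simp
  have "segre_hom (Poly_Mapping.single m c) = [:[:Const c:]:] *
      ([:[:Poly_Mapping.single \<alpha> 1:]:] * ([:monom (Poly_Mapping.single \<beta> 1) (x_degree m):] *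
        monom 1 1 ^ Poly_Mapping.lookup m (Inr None)))"
    unfolding segre_hom_def msubst_single[OF ring_morphism_const_const_Const] prod_UNIV_sum_option
    by (simp only: sum.case option.case t x)
  also have "\<dots> = monom (monom (Poly_Mapping.single (\<alpha> + \<beta>) c) (x_degree m))
      (Poly_Mapping.lookup m (Inr None))"
    unfolding monom_0[symmetric] monom_power mult_monom
    by (simp add: Const_def mult_single mult_monom)
  finally show ?thesis unfolding tx .
qed

section \<open>Monomials modulo the minors\<close>

abbreviation pminors :: "('n::linorder, 'k::field) txpoly set" where
  "pminors \<equiv> {pminor i j | i j. i < j}"

text \<open>Antisymmetry in the two indices removes the restriction to \<open>i < j\<close>.\<close>

lemma pminor_in_span:
  "(pminor i j :: ('n::linorder, 'k::field) txpoly) \<in> ideal.span pminors"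
proof (cases i j rule: linorder_cases)
  case less
  then show ?thesis by (auto intro: ideal.span_base)
next
  case equal
  then show ?thesis by (simp add: pminor_def ideal.span_zero)
next
  case greater
  then have "pminor j i \<in> ideal.span (pminors :: ('n, 'k) txpoly set)"
    by (intro ideal.span_base) blast
  then have "- pminor j i \<in> ideal.span (pminors :: ('n, 'k) txpoly set)"
    by (rule ideal.span_neg)
  then show ?thesis by (simp add: pminor_def)
qed

lemma exponent_split:
  fixes m :: "'v \<Rightarrow>\<^sub>0 nat"
  assumes "Poly_Mapping.lookup m v > 0"
  obtains m' where "m = Poly_Mapping.single v 1 + m'"
proof
  show "m = Poly_Mapping.single v 1 + (m - Poly_Mapping.single v 1)"
    using assms
    by (intro poly_mapping_eqI)
      (auto simp: lookup_add minus_poly_mapping.rep_eq lookup_single when_def)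
qed

lemma single_add_exponent:
  "Poly_Mapping.single (Poly_Mapping.single v 1 + m) (1::'k::comm_ring_1)
     = Var v * Poly_Mapping.single m 1"
  by (simp add: Var_def mult_single)

text \<open>Induction on the degree in \<open>X\<^sub>1, \<dots>, X\<^sub>n\<close>, cancelling a
  common \<open>X\<^sub>i\<close>. If \<open>X\<^sub>i\<close> divides \<open>m\<close> but not
  \<open>m'\<close>, equal images force \<open>t\<^sub>i X\<^sub>j\<close> to divide
  \<open>m'\<close> for some \<open>j\<close>; modulo \<open>pminor j i\<close> this factor may be
  exchanged for \<open>t\<^sub>j X\<^sub>i\<close>.\<close>

lemma single_congruent_mod_pminors:
  fixes m m' :: "'n::{finite,linorder} + 'n option \<Rightarrow>\<^sub>0 nat"
  assumes "tx_exponent m = tx_exponent m'" "x_degree m = x_degree m'"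
    "Poly_Mapping.lookup m (Inr None) = Poly_Mapping.lookup m' (Inr None)"
  shows "Poly_Mapping.single m (1::'k::field) - Poly_Mapping.single m' 1 \<in> ideal.span pminors"
  using assms
proof (induction "x_degree m" arbitrary: m m')
  case 0
  then have "Poly_Mapping.lookup m (Inr (Some i)) = 0" "Poly_Mapping.lookup m' (Inr (Some i)) = 0" for i
    by (simp_all add: x_degree_def)
  note X = this
  have "Poly_Mapping.lookup (tx_exponent m) i = Poly_Mapping.lookup (tx_exponent m') i" for i
    using 0 by simp
  then have t: "Poly_Mapping.lookup m (Inl i) = Poly_Mapping.lookup m' (Inl i)" for i
    by (simp add: lookup_tx_exponent X)
  have "Poly_Mapping.lookup m v = Poly_Mapping.lookup m' v" for v
  proof (cases v)
    case (Inr j)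
    then show ?thesis using X 0 by (cases j) simp_all
  qed (simp add: t)
  then have "m = m'" by (rule poly_mapping_eqI)
  then show ?case by (simp add: ideal.span_zero)
next
  case (Suc k)
  have "\<exists>i. Poly_Mapping.lookup m (Inr (Some i)) > 0"
    using Suc(2) unfolding x_degree_def by (metis gr0I sum.neutral nat.distinct(1))
  then obtain i where i: "Poly_Mapping.lookup m (Inr (Some i)) > 0" ..
  then obtain \<mu> where \<mu>: "m = Poly_Mapping.single (Inr (Some i)) 1 + \<mu>" by (rule exponent_split)
  have step: "Poly_Mapping.single m (1::'k) -
      Poly_Mapping.single (Poly_Mapping.single (Inr (Some i)) 1 + \<mu>') 1 \<in> ideal.span pminors"
    if "tx_exponent (Poly_Mapping.single (Inr (Some i)) 1 + \<mu>') = tx_exponent m"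
      "x_degree (Poly_Mapping.single (Inr (Some i)) 1 + \<mu>') = x_degree m"
      "Poly_Mapping.lookup (Poly_Mapping.single (Inr (Some i)) 1 + \<mu>') (Inr None)
        = Poly_Mapping.lookup m (Inr None)" for \<mu>'
  proof -
    have "Poly_Mapping.single \<mu> (1::'k) - Poly_Mapping.single \<mu>' 1 \<in> ideal.span pminors"
      using that Suc(2) unfolding \<mu>
      by (intro Suc(1)) (simp_all add: tx_exponent_add x_degree_add x_degree_single[simplified] lookup_add)
    then show ?thesis
      unfolding \<mu> single_add_exponent right_diff_distrib[symmetric] by (rule ideal.span_scale)
  qed
  show ?case
  proof (cases "Poly_Mapping.lookup m' (Inr (Some i)) > 0")
    case True
    then obtain \<mu>' where "m' = Poly_Mapping.single (Inr (Some i)) 1 + \<mu>'" by (rule exponent_split)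
    then show ?thesis using step[of \<mu>'] Suc.prems by simp
  next
    case False
    have "Poly_Mapping.lookup (tx_exponent m) i > 0" using i by (simp add: lookup_tx_exponent)
    then have "Poly_Mapping.lookup m' (Inl i) > 0"
      using False Suc.prems(1) by (simp add: lookup_tx_exponent)
    then obtain \<mu>1 where \<mu>1: "m' = Poly_Mapping.single (Inl i) 1 + \<mu>1" by (rule exponent_split)
    have "\<exists>j. Poly_Mapping.lookup m' (Inr (Some j)) > 0"
      using Suc(2) Suc.prems(2) unfolding x_degree_def by (metis gr0I sum.neutral nat.distinct(1))
    then obtain j where "Poly_Mapping.lookup m' (Inr (Some j)) > 0" ..
    then have "Poly_Mapping.lookup \<mu>1 (Inr (Some j)) > 0"
      unfolding \<mu>1 by (simp add: lookup_add lookup_single)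
    then obtain \<nu> where \<nu>: "\<mu>1 = Poly_Mapping.single (Inr (Some j)) 1 + \<nu>" by (rule exponent_split)
    let ?m'' = "Poly_Mapping.single (Inr (Some i)) 1 + (Poly_Mapping.single (Inl j) 1 + \<nu>)"
    have "tx_exponent ?m'' = tx_exponent m'"
      unfolding \<mu>1 \<nu> tx_exponent_add tx_exponent_single by (simp only: ac_simps)
    moreover have "x_degree ?m'' = x_degree m'"
      unfolding \<mu>1 \<nu> x_degree_add x_degree_single by simp
    moreover have "Poly_Mapping.lookup ?m'' (Inr None) = Poly_Mapping.lookup m' (Inr None)"
      unfolding \<mu>1 \<nu> by (simp add: lookup_add lookup_single)
    ultimately have "Poly_Mapping.single m (1::'k) - Poly_Mapping.single ?m'' 1 \<in> ideal.span pminors"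
      using Suc.prems by (intro step) simp_all
    moreover have "Poly_Mapping.single ?m'' (1::'k) - Poly_Mapping.single m' 1
        = Poly_Mapping.single \<nu> 1 * pminor j i"
      unfolding \<mu>1 \<nu> single_add_exponent pminor_def
      by (simp only: right_diff_distrib ac_simps)
    ultimately have "(Poly_Mapping.single m (1::'k) - Poly_Mapping.single ?m'' 1) +
        (Poly_Mapping.single ?m'' 1 - Poly_Mapping.single m' 1) \<in> ideal.span pminors"
      by (intro ideal.span_add) (simp_all add: ideal.span_scale pminor_in_span)
    then show ?thesis by simp
  qed
qed

text \<open>Induction on the number of terms. A term at \<open>m\<close> has to cancel in the image
  against a term at some \<open>m'\<close> with the same image; subtracting a multiple of the
  difference of these two monomials, which lies in the span, removes \<open>m\<close> and introduces
  nothing new.\<close>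

lemma span_pminors_if_segre_hom_zero:
  fixes q :: "('n::{finite,linorder}, 'k::field) txpoly"
  assumes "segre_hom q = 0"
  shows "q \<in> ideal.span pminors"
  using assms
proof (induction "card (Poly_Mapping.keys q)" arbitrary: q rule: less_induct)
  case less
  show ?case
  proof (cases "q = 0")
    case True
    then show ?thesis by (simp add: ideal.span_zero)
  next
    case False
    then obtain m where m: "m \<in> Poly_Mapping.keys q" using keys_eq_empty[of q] by blast
    let ?K = "\<lambda>m'. tx_exponent m' = tx_exponent m \<and> x_degree m' = x_degree m \<and>
      Poly_Mapping.lookup m' (Inr None) = Poly_Mapping.lookup m (Inr None)"
    have "segre_hom q = (\<Sum>m'\<in>Poly_Mapping.keys q.
        segre_hom (Poly_Mapping.single m' (Poly_Mapping.lookup q m')))"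
      by (subst mpoly_sum_singles[of q]) (rule segre.sum)
    then have sum_zero: "(\<Sum>m'\<in>Poly_Mapping.keys q.
        segre_hom (Poly_Mapping.single m' (Poly_Mapping.lookup q m'))) = 0"
      unfolding less.prems by (rule sym)
    \<comment> \<open>Compare coefficients at the image of \<open>m\<close>: the terms of
      \<open>q\<close> with this image, selected by \<open>?K\<close>, have coefficients summing to
      zero, so \<open>m\<close> is not the only one.\<close>
    have "0 = Poly_Mapping.lookup (coeff (coeff (\<Sum>m'\<in>Poly_Mapping.keys q.
        segre_hom (Poly_Mapping.single m' (Poly_Mapping.lookup q m')))
          (Poly_Mapping.lookup m (Inr None))) (x_degree m)) (tx_exponent m)"
      unfolding sum_zero by simp
    also have "\<dots> = (\<Sum>m'\<in>Poly_Mapping.keys q. if ?K m' then Poly_Mapping.lookup q m' else 0)"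
      unfolding coeff_sum lookup_sum
      by (intro sum.cong refl) (auto simp: segre_hom_single lookup_single)
    also have "\<dots> = Poly_Mapping.lookup q m +
        (\<Sum>m'\<in>Poly_Mapping.keys q - {m}. if ?K m' then Poly_Mapping.lookup q m' else 0)"
      using m by (subst sum.remove[of _ m]) simp_all
    finally have "(\<Sum>m'\<in>Poly_Mapping.keys q - {m}. if ?K m' then Poly_Mapping.lookup q m' else 0) \<noteq> 0"
      using m unfolding in_keys_iff by (metis add.right_neutral)
    then obtain m' where "m' \<in> Poly_Mapping.keys q - {m}"
      "(if ?K m' then Poly_Mapping.lookup q m' else 0) \<noteq> 0"
      by (rule sum.not_neutral_contains_not_neutral)
    then have m': "m' \<in> Poly_Mapping.keys q" "m' \<noteq> m" "?K m'"
      by (blast, blast, meson)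
    define r where "r = Const (Poly_Mapping.lookup q m) *
      (Poly_Mapping.single m 1 - Poly_Mapping.single m' 1)"
    have r: "r = Poly_Mapping.single m (Poly_Mapping.lookup q m) -
        Poly_Mapping.single m' (Poly_Mapping.lookup q m)"
      unfolding r_def right_diff_distrib by (simp add: Const_def mult_single)
    have r_span: "r \<in> ideal.span pminors"
      unfolding r_def using m'(3) by (intro ideal.span_scale single_congruent_mod_pminors) auto
    have "segre_hom r = 0" using m'(3) unfolding r by (simp add: segre.diff segre_hom_single)
    then have "segre_hom (q - r) = 0" using less.prems by (simp add: segre.diff)
    moreover have "Poly_Mapping.keys (q - r) \<subseteq> Poly_Mapping.keys q - {m}"
      using m m' by (auto simp: in_keys_iff r lookup_minus lookup_single when_def split: if_splits)
    then have "card (Poly_Mapping.keys (q - r)) < card (Poly_Mapping.keys q)"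
      using m by (intro psubset_card_mono) auto
    ultimately have "q - r \<in> ideal.span pminors" using less.hyps by blast
    then show ?thesis using ideal.span_add[OF _ r_span, of "q - r"] by simp
  qed
qed

section \<open>Elimination and the weight filtration\<close>

lemma ring_morphism_map_poly:
  assumes "ring_morphism \<phi>"
  shows "ring_morphism (map_poly \<phi>)"
proof
  interpret ring_morphism \<phi> by (rule assms)
  show "map_poly \<phi> 1 = 1" by simp
  show "map_poly \<phi> (p + q) = map_poly \<phi> p + map_poly \<phi> q" for p q
    by (rule poly_eqI) (simp add: coeff_map_poly add)
  show "map_poly \<phi> (p * q) = map_poly \<phi> p * map_poly \<phi> q" for p q
    by (rule poly_eqI) (simp add: coeff_map_poly coeff_mult sum mult)
qed

lemma ring_morphism_pcompose: "ring_morphism (\<lambda>p. pcompose p r)"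
  by unfold_locales (simp_all add: pcompose_1 pcompose_add pcompose_mult)

text \<open>The substitution of \<open>fd1 Z\<close> for \<open>W\<close> and \<open>fd Z\<close>
  for \<open>X\<close>: \<open>pcompose\<close> acts on the inner variable, evaluation on the outer
  one, and the variable that remains is \<open>Z\<close>.\<close>

definition segre_elim ::
  "('n::finite, 'k::field) mpoly \<Rightarrow> ('n, 'k) mpoly \<Rightarrow> ('n, 'k) mpoly poly poly \<Rightarrow> ('n, 'k) mpoly poly"
  where "segre_elim fd1 fd w = poly (map_poly (\<lambda>p. pcompose p [:0, fd1:]) w) [:0, fd:]"

text \<open>This is \<open>E\<close>, written as a polynomial of degree at most one in
  \<open>X\<close> whose coefficients are polynomials in \<open>W\<close>.\<close>

definition segre_equation ::
  "('n::finite, 'k::field) mpoly \<Rightarrow> ('n, 'k) mpoly \<Rightarrow> ('n, 'k) mpoly poly poly"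
  where "segre_equation fd1 fd = [:- monom fd 1, [:fd1:]:]"

lemma ring_morphism_segre_elim: "ring_morphism (segre_elim fd1 fd)"
  unfolding segre_elim_def
  by (rule ring_morphism_comp[OF ring_morphism_poly ring_morphism_map_poly[OF ring_morphism_pcompose]])

lemma pcompose_monom_1: "pcompose (monom a 1) [:0, b:] = monom (a * b) (1::nat)"
  by (simp add: monom_Suc monom_0 pcompose_pCons mult.commute)

lemma segre_elim_const: "segre_elim fd1 fd [:p:] = pcompose p [:0, fd1:]"
  by (simp add: segre_elim_def map_poly_pCons)

lemma segre_elim_monom: "segre_elim fd1 fd (monom 1 1) = monom fd 1"
proof -
  have "map_poly (\<lambda>p. pcompose p [:0, fd1:]) (monom 1 1) = monom 1 1"
    by (simp add: map_poly_monom pcompose_1)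
  then show ?thesis by (simp add: segre_elim_def poly_monom monom_altdef)
qed

text \<open>Both sides are substitutions, so agreement on the variables is enough.\<close>

lemma rees_hom_eq_segre: "rees_hom fd1 fd q = segre_elim fd1 fd (segre_hom q)"
proof -
  have "segre_elim fd1 fd (case v of Inl i \<Rightarrow> [:[:Var i:]:]
        | Inr None \<Rightarrow> monom 1 1 | Inr (Some i) \<Rightarrow> [:monom (Var i) 1:])
      = (case v of Inl i \<Rightarrow> [:Var i:] | Inr j \<Rightarrow> monom (monoid_param fd1 fd j) 1)" for v
  proof (cases v)
    case (Inr j)
    show ?thesis unfolding Inr monoid_param_def
      by (cases j) (simp_all only: sum.case option.case segre_elim_const segre_elim_monom
        pcompose_monom_1)
  qed (simp only: sum.case segre_elim_const pcompose_const)
  then show ?thesis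
    unfolding segre_hom_def morphism_msubst[OF ring_morphism_segre_elim] rees_hom_def
      segre_elim_const pcompose_const by presburger
qed

lemma segre_equation_altdef:
  "segre_equation fd1 fd = [:[:fd1:]:] * monom 1 1 - [:monom fd 1:]"
  by (simp add: segre_equation_def monom_Suc monom_0)

lemma segre_elim_equation: "segre_elim fd1 fd (segre_equation fd1 fd) = 0"
proof -
  interpret ring_morphism "segre_elim fd1 fd" by (rule ring_morphism_segre_elim)
  show ?thesis
    unfolding segre_equation_altdef diff mult segre_elim_const segre_elim_monom pcompose_const
      pcompose_monom_1
    by (simp add: monom_Suc monom_0 mult.commute)
qed

text \<open>Modulo the linear divisor, \<open>a\<close> times the variable may be replaced by
  \<open>b\<close>. Hence one more factor \<open>a\<close> per induction step keeps the remainder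
  constant.\<close>

lemma linear_pseudo_division:
  fixes a b :: "'a::idom"
  shows "\<exists>N v r. smult (a ^ N) w = [:- b, a:] * v + [:r:]"
proof (induction w)
  case 0
  have "smult (a ^ 0) 0 = [:- b, a:] * 0 + [:0:]" by simp
  then show ?case by blast
next
  case (pCons c w)
  then obtain N v r where IH: "smult (a ^ N) w = [:- b, a:] * v + [:r:]" by blast
  define L where "L = [:- b, a:]"
  have L_r: "L * [:r:] + [:r * b:] = smult a (pCons 0 [:r:])" by (simp add: L_def mult.commute)
  have "smult (a ^ Suc N) (pCons c w) = [:a ^ Suc N * c:] + smult a (pCons 0 (smult (a ^ N) w))"
    by simp
  also have "smult a (pCons 0 (smult (a ^ N) w)) = L * smult a (pCons 0 v) + smult a (pCons 0 [:r:])"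
    unfolding IH L_def[symmetric] by (simp add: smult_add_right)
  also have "[:a ^ Suc N * c:] + \<dots> =
      L * (smult a (pCons 0 v) + [:r:]) + ([:r * b:] + [:a ^ Suc N * c:])"
    unfolding L_r[symmetric] by (simp only: distrib_left ac_simps)
  also have "[:r * b:] + [:a ^ Suc N * c:] = [:r * b + a ^ Suc N * c:]" by simp
  finally show ?case unfolding L_def by blast
qed

text \<open>One factor \<open>a\<close> is cancelled at a time. Modulo \<open>a\<close> the divisor
  becomes the constant \<open>- b\<close>, by which cancellation is allowed by assumption, so
  \<open>a\<close> divides all coefficients of the quotient \<open>v\<close>.\<close>

lemma linear_dvd_cancel:
  fixes a b :: "'a::idom"
  assumes "a \<noteq> 0" "\<And>c. a dvd c * b \<Longrightarrow> a dvd c" "smult (a ^ N) w = [:- b, a:] * v"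
  shows "[:- b, a:] dvd w"
  using assms(3)
proof (induction N arbitrary: v)
  case 0
  then have "w = [:- b, a:] * v" by (simp only: power_0 smult_1_left)
  then show ?case by (rule dvdI)
next
  case (Suc N)
  have "a dvd coeff v i" for i
  proof -
    have "coeff ([:- b, a:] * v) i = a * coeff (pCons 0 v) i - coeff v i * b"
      by (simp add: mult.commute coeff_pCons split: nat.split)
    moreover have "a dvd coeff ([:- b, a:] * v) i" unfolding Suc.prems[symmetric] by simp
    ultimately have "a dvd a * coeff (pCons 0 v) i - coeff v i * b" by metis
    then have "a dvd coeff v i * b" by (metis dvd_diff_right_iff dvd_triv_left)
    then show ?thesis by (rule assms(2))
  qed
  then have "[:a:] dvd v" by (simp add: const_poly_dvd_iff)
  then obtain v' where "v = [:a:] * v'" ..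
  then have "smult a (smult (a ^ N) w) = smult a ([:- b, a:] * v')"
    using Suc.prems by simp
  then have "smult (a ^ N) w = [:- b, a:] * v'"
    using \<open>a \<noteq> 0\<close> by (metis smult_cancel)
  then show ?case by (rule Suc.IH)
qed

text \<open>Pseudo-division by \<open>E\<close> leaves a remainder \<open>r\<close> free of
  \<open>X\<close>. Elimination sends \<open>r\<close> to its composition with \<open>fd1 Z\<close>,
  which must vanish, so \<open>r = 0\<close>; coprimality then cancels the power of
  \<open>fd1\<close>.\<close>

lemma segre_equation_dvd:
  fixes fd1 fd :: "('n::{finite,linorder}, 'k::field) mpoly"
  assumes "no_common_factor fd1 fd" "fd1 \<noteq> 0" "segre_elim fd1 fd w = 0"
  shows "segre_equation fd1 fd dvd w"
proof -
  interpret e: ring_morphism "segre_elim fd1 fd" by (rule ring_morphism_segre_elim)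
  obtain N v r where eq: "smult ([:fd1:] ^ N) w = [:- monom fd 1, [:fd1:]:] * v + [:r:]"
    using linear_pseudo_division[of "[:fd1:]" w "monom fd 1"] by blast
  have "[:[:fd1:] ^ N:] * w = smult ([:fd1:] ^ N) w" by simp
  also note eq[folded segre_equation_def]
  finally have "[:[:fd1:] ^ N:] * w = segre_equation fd1 fd * v + [:r:]" .
  then have "segre_elim fd1 fd ([:[:fd1:] ^ N:] * w) = pcompose r [:0, fd1:]"
    by (simp only: e.add e.mult segre_elim_equation segre_elim_const mult_zero_left add_0_left)
  then have "pcompose r [:0, fd1:] = 0"
    unfolding e.mult assms(3) by simp
  then have "r = 0" using \<open>fd1 \<noteq> 0\<close> by (simp add: pcompose_eq_0_iff)
  then have eq: "smult ([:fd1:] ^ N) w = [:- monom fd 1, [:fd1:]:] * v"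
    using eq by (simp only: pCons_0_0 add_0_right)
  \<comment> \<open>Multiplication by \<open>monom fd 1\<close> multiplies the coefficients by
    \<open>fd\<close> and shifts them, so cancellation can be done coefficientwise in the factorial
    ring of polynomials in \<open>t\<close>.\<close>
  have cancel: "[:fd1:] dvd c" if "[:fd1:] dvd c * monom fd 1" for c
  proof -
    have "fd1 dvd coeff c i" for i
    proof (rule dvd_cancel_mpoly[OF assms(1,2)])
      have "fd1 dvd coeff (monom fd 1 * c) (Suc i)"
        using that unfolding const_poly_dvd_iff by (simp only: mult.commute)
      then show "fd1 dvd coeff c i * fd" unfolding coeff_monom_mult by (simp add: mult.commute)
    qed
    then show ?thesis by (simp add: const_poly_dvd_iff)
  qed
  show ?thesis
    unfolding segre_equation_def
    by (rule linear_dvd_cancel[OF _ cancel eq]) (use \<open>fd1 \<noteq> 0\<close> in simp_all)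
qed

section \<open>Order in \<open>t\<close> and the weight bound on quotients\<close>

definition min_degree_ge :: "nat \<Rightarrow> ('v::finite, 'k::zero) mpoly \<Rightarrow> bool" where
  "min_degree_ge s p \<longleftrightarrow> (\<forall>m\<in>Poly_Mapping.keys p. s \<le> mdeg m)"

lemma mdeg_add: "mdeg (a + b) = mdeg a + mdeg b"
  by (simp add: mdeg_def lookup_add sum.distrib)

lemma mdeg_single: "mdeg (Poly_Mapping.single v n) = n"
  by (simp add: mdeg_def lookup_single when_def sum.delta)

lemma min_degree_ge_zero [simp]: "min_degree_ge s 0"
  by (simp add: min_degree_ge_def)

lemma min_degree_ge_mono: "min_degree_ge s p \<Longrightarrow> r \<le> s \<Longrightarrow> min_degree_ge r p"
  by (auto simp: min_degree_ge_def)

lemma min_degree_ge_add: "min_degree_ge s p \<Longrightarrow> min_degree_ge s q \<Longrightarrow> min_degree_ge s (p + q)"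
  using keys_add[of p q] unfolding min_degree_ge_def by blast

lemma min_degree_ge_diff:
  fixes p q :: "('v::finite, 'k::comm_ring_1) mpoly"
  shows "min_degree_ge s p \<Longrightarrow> min_degree_ge s q \<Longrightarrow> min_degree_ge s (p - q)"
  using keys_diff[of p q] unfolding min_degree_ge_def by blast

lemma min_degree_ge_mult:
  fixes p q :: "('v::finite, 'k::comm_ring_1) mpoly"
  assumes "min_degree_ge s p" "min_degree_ge r q"
  shows "min_degree_ge (s + r) (p * q)"
  unfolding min_degree_ge_def
proof
  fix m assume "m \<in> Poly_Mapping.keys (p * q)"
  then obtain a b where m: "m = a + b" "a \<in> Poly_Mapping.keys p" "b \<in> Poly_Mapping.keys q"
    using keys_mult by blast
  have "s \<le> mdeg a" "r \<le> mdeg b"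
    using assms m(2,3) unfolding min_degree_ge_def by blast+
  then show "s + r \<le> mdeg m" unfolding m(1) mdeg_add by (rule add_mono)
qed

lemma min_degree_ge_homogeneous: "homogeneous e p \<Longrightarrow> min_degree_ge e p"
  by (simp add: homogeneous_def min_degree_ge_def)

text \<open>Let \<open>low\<close> be the part of \<open>w\<close> of degree less than
  \<open>s\<close>. Terms of \<open>f * low\<close> have degree less than \<open>e + s\<close>, yet
  \<open>f * low = f * w - f * (w - low)\<close> contains only terms of degree at least
  \<open>e + s\<close>; so it is zero.\<close>

lemma min_degree_ge_cancel_homogeneous:
  fixes f w :: "('v::{finite,linorder}, 'k::field) mpoly"
  assumes f: "homogeneous e f" "f \<noteq> 0" and fw: "min_degree_ge (e + s) (f * w)"
  shows "min_degree_ge s w"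
proof -
  define low where "low = (\<Sum>m\<in>{m\<in>Poly_Mapping.keys w. mdeg m < s}.
    Poly_Mapping.single m (Poly_Mapping.lookup w m))"
  have low: "Poly_Mapping.lookup low m = (if mdeg m < s then Poly_Mapping.lookup w m else 0)" for m
    unfolding low_def by (simp add: lookup_sum lookup_single when_def sum.delta' in_keys_iff)
  have "min_degree_ge s (w - low)"
    unfolding min_degree_ge_def by (auto simp: in_keys_iff lookup_minus low split: if_splits)
  then have "min_degree_ge (e + s) (f * (w - low))"
    by (rule min_degree_ge_mult[OF min_degree_ge_homogeneous[OF f(1)]])
  then have "min_degree_ge (e + s) (f * w - f * (w - low))"
    by (rule min_degree_ge_diff[OF fw])
  then have ge: "min_degree_ge (e + s) (f * low)" by (simp add: right_diff_distrib)
  have "m \<notin> Poly_Mapping.keys (f * low)" for m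
  proof
    assume m: "m \<in> Poly_Mapping.keys (f * low)"
    then obtain a b where "m = a + b" "a \<in> Poly_Mapping.keys f" "b \<in> Poly_Mapping.keys low"
      using keys_mult by blast
    moreover from this have "mdeg b < s" by (auto simp: in_keys_iff low split: if_splits)
    ultimately have "mdeg m < e + s" using f(1) by (simp add: homogeneous_def mdeg_add)
    then show False using ge m unfolding min_degree_ge_def by fastforce
  qed
  then have "f * low = 0" using keys_eq_empty[of "f * low"] by blast
  then have "low = 0" using f(2) by simp
  have "s \<le> mdeg m" if "m \<in> Poly_Mapping.keys w" for m
    using low[of m] that unfolding \<open>low = 0\<close> in_keys_iff by (cases "mdeg m < s") auto
  then show ?thesis unfolding min_degree_ge_def by blast
qed

lemma x_degree_le_mdeg: "x_degree m \<le> mdeg (tx_exponent m)"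
  by (simp add: x_degree_def mdeg_def lookup_tx_exponent sum_mono)

text \<open>In the image each factor \<open>W\<close> comes with a factor
  \<open>t\<^sub>i\<close>.\<close>

lemma min_degree_ge_segre_hom: "min_degree_ge k (coeff (coeff (segre_hom q) l) k)"
proof (induction q rule: mpoly_induct)
  case (single m c)
  show ?case
    using x_degree_le_mdeg[of m] by (auto simp: segre_hom_single min_degree_ge_def)
qed (simp add: segre.add min_degree_ge_add)

text \<open>Descending induction on the power \<open>l\<close> of \<open>X\<close>. The coefficient
  of \<open>E * w\<close> at \<open>Suc l\<close> expresses \<open>fd1\<close> times
  \<open>coeff w l\<close> through the image and \<open>coeff w (Suc l)\<close>, both of order at
  least \<open>k\<close> at the power \<open>k\<close> of \<open>W\<close>; cancelling
  \<open>fd1\<close> costs \<open>d - 1\<close>. For \<open>k < d - 1\<close> the bound is zero by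
  truncated subtraction.\<close>

lemma min_degree_ge_quotient:
  fixes fd1 fd :: "('n::{finite,linorder}, 'k::field) mpoly"
  assumes "homogeneous (d - 1) fd1" "homogeneous d fd" "d \<ge> 1" "fd1 \<noteq> 0"
    and q: "segre_hom q = segre_equation fd1 fd * w"
  shows "min_degree_ge (k - (d - 1)) (coeff (coeff w l) k)"
proof (induction "Suc (degree w) - l" arbitrary: l k rule: less_induct)
  case less
  show ?case
  proof (cases "l > degree w \<or> k < d - 1")
    case True
    then show ?thesis by (auto simp: coeff_eq_0 min_degree_ge_def)
  next
    case False
    have IH: "min_degree_ge (k' - (d - 1)) (coeff (coeff w (Suc l)) k')" for k'
      using False by (intro less) auto
    have "coeff (segre_hom q) (Suc l) = [:fd1:] * coeff w l - monom fd 1 * coeff w (Suc l)"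
      unfolding q segre_equation_def by simp
    then have eq: "fd1 * coeff (coeff w l) k
        = coeff (coeff (segre_hom q) (Suc l)) k + coeff (monom fd 1 * coeff w (Suc l)) k"
      by simp
    have "min_degree_ge k (coeff (monom fd 1 * coeff w (Suc l)) k)"
    proof (cases k)
      case (Suc k')
      have "min_degree_ge (d + (k' - (d - 1))) (fd * coeff (coeff w (Suc l)) k')"
        by (intro min_degree_ge_mult min_degree_ge_homogeneous assms IH)
      \<comment> \<open>The two bounds agree unless \<open>k' < d - 1\<close>; in that case
        truncation makes the available one larger than required.\<close>
      then have "min_degree_ge (Suc k') (fd * coeff (coeff w (Suc l)) k')"
        by (rule min_degree_ge_mono) (use assms(3) in linarith)
      then show ?thesis unfolding coeff_monom_mult using Suc by simp
    qed (simp add: coeff_monom_mult)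
    then have "min_degree_ge k (fd1 * coeff (coeff w l) k)"
      unfolding eq by (rule min_degree_ge_add[OF min_degree_ge_segre_hom])
    moreover have "d - 1 + (k - (d - 1)) = k" using False by linarith
    ultimately show ?thesis
      using min_degree_ge_cancel_homogeneous[OF assms(1,4), of "k - (d - 1)"] by metis
  qed
qed

text \<open>Each of the \<open>k\<close> factors \<open>W\<close> is paired with some
  \<open>t\<^sub>i\<close> and lifted to \<open>X\<^sub>i\<close>; the degree of \<alpha> provides
  enough partners.\<close>

lemma segre_hom_monomial_surj:
  fixes c :: "'k::field" and \<alpha> :: "'n::finite \<Rightarrow>\<^sub>0 nat"
  assumes "k \<le> mdeg \<alpha>"
  shows "\<exists>q. segre_hom q = monom (monom (Poly_Mapping.single \<alpha> c) k) l"
  using assms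
proof (induction k arbitrary: \<alpha>)
  case 0
  have "segre_hom (tincl (Poly_Mapping.single \<alpha> c) * Xlast ^ l)
      = monom (monom (Poly_Mapping.single \<alpha> c) 0) l"
    unfolding segre.mult segre.power segre_hom_tincl segre_hom_Var
    by (simp add: monom_power monom_0 smult_monom)
  then show ?case ..
next
  case (Suc k)
  then have "mdeg \<alpha> \<noteq> 0" by simp
  then obtain i where "Poly_Mapping.lookup \<alpha> i > 0" by (auto simp: mdeg_def)
  then obtain \<beta> where \<beta>: "\<alpha> = Poly_Mapping.single i 1 + \<beta>" by (rule exponent_split)
  then have "k \<le> mdeg \<beta>" using Suc.prems by (simp add: mdeg_add mdeg_single)
  then obtain q where "segre_hom q = monom (monom (Poly_Mapping.single \<beta> c) k) l"
    using Suc.IH by blast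
  then have "segre_hom (Xvar i * q) = monom (monom (Poly_Mapping.single \<alpha> c) (Suc k)) l"
    unfolding segre.mult segre_hom_Var \<beta>
    by (simp add: smult_monom mult_monom Var_def mult_single)
  then show ?case ..
qed

section \<open>Coefficients of low degree\<close>

text \<open>One coefficient of a product as a convolution over an explicit set \<open>D\<close>. For
  exponents of degree at most two \<open>D\<close> is listed below, which gives product rules for
  the lowest coefficients.\<close>

lemma lookup_mult_decompositions:
  fixes p q :: "('m::comm_monoid_add) \<Rightarrow>\<^sub>0 ('k::comm_ring_1)"
  assumes D: "\<And>a b. a + b = k \<longleftrightarrow> (a, b) \<in> D" "finite D"
  shows "Poly_Mapping.lookup (p * q) k =
    (\<Sum>(a, b)\<in>D. Poly_Mapping.lookup p a * Poly_Mapping.lookup q b)"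
proof (induction p rule: mpoly_induct)
  case (single m x)
  show ?case
  proof (induction q rule: mpoly_induct)
    case (single n y)
    have "(\<Sum>(a, b)\<in>D. Poly_Mapping.lookup (Poly_Mapping.single m x) a *
          Poly_Mapping.lookup (Poly_Mapping.single n y) b)
        = (\<Sum>ab\<in>D. if ab = (m, n) then x * y else 0)"
      by (rule sum.cong) (auto simp: lookup_single when_def split: if_splits)
    also have "\<dots> = (if m + n = k then x * y else 0)"
      using D by (simp add: sum.delta)
    finally show ?case by (simp add: mult_single lookup_single when_def)
  next
    case (add p q)
    then show ?case
      by (simp add: distrib_left lookup_add sum.distrib case_prod_unfold)
  qed
next
  case (add p q)
  then show ?case
    by (simp add: distrib_right lookup_add sum.distrib case_prod_unfold)
qed

abbreviation expo :: "'v \<Rightarrow> 'v \<Rightarrow>\<^sub>0 nat" where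
  "expo v \<equiv> Poly_Mapping.single v (Suc 0)"

text \<open>Exponents are natural numbers, so a summand vanishes wherever the sum does.\<close>

lemma exponent_below_pair:
  fixes a b :: "'v \<Rightarrow>\<^sub>0 nat"
  assumes "u \<noteq> v" "a + b = Poly_Mapping.single u k + Poly_Mapping.single v l"
  shows "a = Poly_Mapping.single u (Poly_Mapping.lookup a u)
      + Poly_Mapping.single v (Poly_Mapping.lookup a v)"
    and "Poly_Mapping.lookup a u + Poly_Mapping.lookup b u = k"
    and "Poly_Mapping.lookup a v + Poly_Mapping.lookup b v = l"
proof -
  have eq: "Poly_Mapping.lookup a w + Poly_Mapping.lookup b w
      = (if w = u then k else 0) + (if w = v then l else 0)" for w
    using arg_cong[OF assms(2), of "\<lambda>m. Poly_Mapping.lookup m w"]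
    by (simp add: lookup_add lookup_single when_def eq_commute[of w])
  show "Poly_Mapping.lookup a u + Poly_Mapping.lookup b u = k" using eq[of u] assms(1) by simp
  show "Poly_Mapping.lookup a v + Poly_Mapping.lookup b v = l" using eq[of v] assms(1) by simp
  show "a = Poly_Mapping.single u (Poly_Mapping.lookup a u)
      + Poly_Mapping.single v (Poly_Mapping.lookup a v)"
  proof (rule poly_mapping_eqI)
    fix w
    show "Poly_Mapping.lookup a w = Poly_Mapping.lookup (Poly_Mapping.single u (Poly_Mapping.lookup a u)
      + Poly_Mapping.single v (Poly_Mapping.lookup a v)) w"
      using eq[of w] assms(1) by (cases "w = u"; cases "w = v") (simp_all add: lookup_add lookup_single when_def)
  qed
qed

lemma exponent_pair_decompositions:
  fixes a b :: "'v \<Rightarrow>\<^sub>0 nat"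
  assumes "u \<noteq> v"
  shows "a + b = expo u + expo v \<longleftrightarrow>
    (a, b) \<in> {(0, expo u + expo v), (expo u, expo v), (expo v, expo u), (expo u + expo v, 0)}"
proof
  assume eq: "a + b = expo u + expo v"
  define x y x' y' where "x = Poly_Mapping.lookup a u" "y = Poly_Mapping.lookup a v"
    "x' = Poly_Mapping.lookup b u" "y' = Poly_Mapping.lookup b v"
  note xy = this
  note a = exponent_below_pair[OF assms eq, folded xy]
  from eq have "b + a = expo u + expo v" by (simp only: add.commute)
  note b = exponent_below_pair(1)[OF assms this, folded xy]
  have "x = 0 \<and> x' = Suc 0 \<or> x = Suc 0 \<and> x' = 0" "y = 0 \<and> y' = Suc 0 \<or> y = Suc 0 \<and> y' = 0"
    using a(2,3) by linarith+
  then show "(a, b) \<in> {(0, expo u + expo v), (expo u, expo v), (expo v, expo u), (expo u + expo v, 0)}"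
    unfolding a(1) b by (elim disjE conjE) simp_all
qed (auto simp: add.commute)

lemma exponent_single_decompositions:
  fixes a b :: "'v \<Rightarrow>\<^sub>0 nat"
  shows "a + b = expo u \<longleftrightarrow> (a, b) \<in> {(0, expo u), (expo u, 0)}"
proof
  assume eq: "a + b = expo u"
  have "Poly_Mapping.lookup a w + Poly_Mapping.lookup b w = (if w = u then 1 else 0)" for w
    using arg_cong[OF eq, of "\<lambda>m. Poly_Mapping.lookup m w"]
    by (simp add: lookup_add lookup_single when_def eq_commute[of w])
  note eq_w = this
  show "(a, b) \<in> {(0, expo u), (expo u, 0)}"
  proof (cases "Poly_Mapping.lookup a u = 0")
    case True
    have "Poly_Mapping.lookup a w = 0" for w using eq_w[of w] True by (cases "w = u") auto
    then have "a = 0" by (intro poly_mapping_eqI) simp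
    then show ?thesis using eq by simp
  next
    case False
    have "Poly_Mapping.lookup b w = 0" for w using eq_w[of w] False by (cases "w = u") auto
    then have "b = 0" by (intro poly_mapping_eqI) simp
    then show ?thesis using eq by simp
  qed
qed auto

lemma exponent_zero_decompositions:
  fixes a b :: "'v \<Rightarrow>\<^sub>0 nat"
  shows "a + b = 0 \<longleftrightarrow> (a, b) \<in> {(0, 0)}"
proof
  assume eq: "a + b = 0"
  have "Poly_Mapping.lookup a w + Poly_Mapping.lookup b w = 0" for w
    using arg_cong[OF eq, of "\<lambda>m. Poly_Mapping.lookup m w"] by (simp add: lookup_add)
  then have "a = 0" "b = 0" by (simp_all add: poly_mapping_eq_iff fun_eq_iff)
  then show "(a, b) \<in> {(0, 0)}" by simp
qed auto

lemma expo_neq [simp]: "expo u \<noteq> 0" "0 \<noteq> expo u" "expo u + m \<noteq> 0" "0 \<noteq> expo u + m"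
  for m :: "'v \<Rightarrow>\<^sub>0 nat"
proof -
  have "Poly_Mapping.lookup (expo u) u \<noteq> Poly_Mapping.lookup 0 u"
    "Poly_Mapping.lookup (expo u + m) u \<noteq> Poly_Mapping.lookup 0 u"
    by (simp_all add: lookup_add)
  then show "expo u \<noteq> 0" "0 \<noteq> expo u" "expo u + m \<noteq> 0" "0 \<noteq> expo u + m" by metis+
qed

lemma expo_eq_iff: "expo u = expo v \<longleftrightarrow> u = v"
proof
  assume "expo u = expo v"
  then have "Poly_Mapping.lookup (expo u) v = Poly_Mapping.lookup (expo v) v" by simp
  then show "u = v" by (simp add: lookup_single when_def split: if_splits)
qed simp

lemma expo_pair_neq_single: "expo u + expo v \<noteq> expo (w :: 'v::finite)"
proof
  assume "expo u + expo v = expo w"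
  then have "mdeg (expo u + expo v) = mdeg (expo w)" by simp
  then show False by (simp only: mdeg_add mdeg_single)
qed

lemma lookup_mult_zero:
  "Poly_Mapping.lookup (p * q) 0 = Poly_Mapping.lookup p 0 * Poly_Mapping.lookup q (0 :: 'v \<Rightarrow>\<^sub>0 nat)"
  for p q :: "('v, 'k::comm_ring_1) mpoly"
  by (subst lookup_mult_decompositions[OF exponent_zero_decompositions]) simp_all

lemma lookup_mult_expo:
  "Poly_Mapping.lookup (p * q) (expo u) =
     Poly_Mapping.lookup p 0 * Poly_Mapping.lookup q (expo u)
     + Poly_Mapping.lookup p (expo u) * Poly_Mapping.lookup q 0"
  for p q :: "('v, 'k::comm_ring_1) mpoly"
  by (subst lookup_mult_decompositions[OF exponent_single_decompositions]) simp_all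

lemma lookup_mult_expo_pair:
  fixes p q :: "('v::finite, 'k::comm_ring_1) mpoly"
  assumes "u \<noteq> v"
  shows "Poly_Mapping.lookup (p * q) (expo u + expo v) =
     Poly_Mapping.lookup p 0 * Poly_Mapping.lookup q (expo u + expo v)
     + Poly_Mapping.lookup p (expo u) * Poly_Mapping.lookup q (expo v)
     + Poly_Mapping.lookup p (expo v) * Poly_Mapping.lookup q (expo u)
     + Poly_Mapping.lookup p (expo u + expo v) * Poly_Mapping.lookup q 0"
proof -
  have ne: "expo u + expo v \<noteq> expo u" "expo u + expo v \<noteq> expo v" "expo u \<noteq> expo v"
    by (rule expo_pair_neq_single, rule expo_pair_neq_single) (simp add: expo_eq_iff assms)
  note ne' = this this[symmetric]
  show ?thesis
    by (subst lookup_mult_decompositions[OF exponent_pair_decompositions[OF assms]])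
      (use ne' in \<open>simp_all add: add.assoc\<close>)
qed

lemma lookup_Var: "Poly_Mapping.lookup (Var v) m = (if m = expo v then 1 else 0)"
  by (auto simp: Var_def lookup_single when_def)

section \<open>Bidegrees\<close>

lemma bihomogeneous_degrees:
  assumes "bihomogeneous a b p" "Poly_Mapping.lookup p m \<noteq> 0"
  shows "(\<Sum>i\<in>UNIV. Poly_Mapping.lookup m (Inl i)) = a" "(\<Sum>j\<in>UNIV. Poly_Mapping.lookup m (Inr j)) = b"
  using assms by (auto simp: bihomogeneous_def in_keys_iff)

lemma bihomogeneous_diff:
  fixes p q :: "('n::finite, 'k::comm_ring_1) txpoly"
  shows "bihomogeneous a b p \<Longrightarrow> bihomogeneous a b q \<Longrightarrow> bihomogeneous a b (p - q)"
  using keys_diff[of p q] unfolding bihomogeneous_def by blast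

lemma bihomogeneous_add:
  fixes p q :: "('n::finite, 'k::comm_ring_1) txpoly"
  shows "bihomogeneous a b p \<Longrightarrow> bihomogeneous a b q \<Longrightarrow> bihomogeneous a b (p + q)"
  using keys_add[of p q] unfolding bihomogeneous_def by blast

lemma bihomogeneous_sum:
  fixes f :: "'i \<Rightarrow> ('n::finite, 'k::comm_ring_1) txpoly"
  assumes "\<And>i. bihomogeneous a b (f i)"
  shows "bihomogeneous a b (sum f I)"
proof (induction I rule: infinite_finite_induct)
  case (insert i I)
  then show ?case using bihomogeneous_add[OF assms[of i]] by simp
qed (simp_all add: bihomogeneous_def)

lemma bihomogeneous_mult:
  fixes p q :: "('n::finite, 'k::comm_ring_1) txpoly"
  assumes "bihomogeneous a b p" "bihomogeneous a' b' q"
  shows "bihomogeneous (a + a') (b + b') (p * q)"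
  unfolding bihomogeneous_def
proof
  fix m assume "m \<in> Poly_Mapping.keys (p * q)"
  then obtain k l where m: "m = k + l" "k \<in> Poly_Mapping.keys p" "l \<in> Poly_Mapping.keys q"
    using keys_mult by blast
  note deg = assms(1)[unfolded bihomogeneous_def, rule_format, OF m(2)]
    assms(2)[unfolded bihomogeneous_def, rule_format, OF m(3)]
  show "(\<Sum>i\<in>UNIV. Poly_Mapping.lookup m (Inl i)) = a + a' \<and>
      (\<Sum>j\<in>UNIV. Poly_Mapping.lookup m (Inr j)) = b + b'"
    unfolding m(1) lookup_add sum.distrib using deg by simp
qed

lemma bihomogeneous_X: "bihomogeneous 0 1 (Var (Inr j) :: ('n::finite, 'k::comm_ring_1) txpoly)"
  by (simp add: bihomogeneous_def Var_def lookup_single when_def sum.delta')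

lemma tincl_single:
  "tincl (Poly_Mapping.single m c) =
     Poly_Mapping.single (\<Sum>v\<in>UNIV. Poly_Mapping.single (Inl v) (Poly_Mapping.lookup m v)) c"
  unfolding tincl_def msubst_single[OF ring_morphism_Const] prod_Var_power
  by (rule single_eq_Const_mult[symmetric])

lemma lookup_embed_exponent:
  "Poly_Mapping.lookup (\<Sum>v\<in>UNIV. Poly_Mapping.single (Inl v) (f v)) (Inl i) = f (i :: 'n::finite)"
  "Poly_Mapping.lookup (\<Sum>v\<in>UNIV. Poly_Mapping.single (Inl v) (f v)) (Inr j) = (0 :: nat)"
  by (simp_all add: lookup_sum lookup_single when_def sum.delta)

lemma tincl_add: "tincl (p + q) = tincl p + tincl q"
  unfolding tincl_def by (rule msubst_add[OF ring_morphism_Const])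

lemma lookup_tincl:
  fixes p :: "('n::finite, 'k::field) mpoly"
  shows "Poly_Mapping.lookup (tincl p) (\<Sum>v\<in>UNIV. Poly_Mapping.single (Inl v) (Poly_Mapping.lookup m v))
    = Poly_Mapping.lookup p m"
proof (induction p rule: mpoly_induct)
  case (single m' c)
  have "(\<Sum>v\<in>UNIV. Poly_Mapping.single (Inl v) (Poly_Mapping.lookup m' v)) =
      (\<Sum>v\<in>UNIV. Poly_Mapping.single (Inl v :: 'n + 'n option) (Poly_Mapping.lookup m v)) \<longleftrightarrow> m' = m"
    (is "?e m' = ?e m \<longleftrightarrow> _")
  proof
    assume "?e m' = ?e m"
    then have "Poly_Mapping.lookup (?e m') (Inl i) = Poly_Mapping.lookup (?e m) (Inl i)" for i
      by simp
    then show "m' = m" unfolding lookup_embed_exponent by (rule poly_mapping_eqI)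
  qed simp
  then show ?case by (simp add: tincl_single lookup_single)
qed (simp add: tincl_add lookup_add)

lemma lookup_tincl_expo:
  fixes p :: "('n::finite, 'k::field) mpoly"
  shows "Poly_Mapping.lookup (tincl p) (expo (Inl k)) = Poly_Mapping.lookup p (expo k)"
proof -
  have "(\<Sum>v\<in>UNIV. Poly_Mapping.single (Inl v :: 'n + 'n option) (Poly_Mapping.lookup (expo k) v)) = expo (Inl k)"
  proof (rule poly_mapping_eqI)
    fix w :: "'n + 'n option"
    show "Poly_Mapping.lookup (\<Sum>v\<in>UNIV. Poly_Mapping.single (Inl v) (Poly_Mapping.lookup (expo k) v)) w
        = Poly_Mapping.lookup (expo (Inl k)) w"
      by (cases w) (simp_all only: lookup_embed_exponent, simp_all add: lookup_single when_def)
  qed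
  then show ?thesis using lookup_tincl[of p "expo k"] by simp
qed

lemma lookup_tincl_zero: "Poly_Mapping.lookup (tincl p) 0 = Poly_Mapping.lookup p 0"
  using lookup_tincl[of p 0] by simp

lemma bihomogeneous_tincl:
  fixes p :: "('n::finite, 'k::field) mpoly"
  assumes "homogeneous e p"
  shows "bihomogeneous e 0 (tincl p)"
proof -
  interpret t: ring_morphism "tincl :: ('n, 'k) mpoly \<Rightarrow> _"
    unfolding tincl_def by (rule ring_morphism_msubst[OF ring_morphism_Const])
  show ?thesis
    unfolding bihomogeneous_def
  proof
    fix m assume m: "m \<in> Poly_Mapping.keys (tincl p)"
    have "tincl p = (\<Sum>m\<in>Poly_Mapping.keys p. tincl (Poly_Mapping.single m (Poly_Mapping.lookup p m)))"
      by (subst mpoly_sum_singles[of p]) (rule t.sum)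
    with m have "m \<in> (\<Union>m\<in>Poly_Mapping.keys p.
        Poly_Mapping.keys (tincl (Poly_Mapping.single m (Poly_Mapping.lookup p m))))"
      using keys_sum by fastforce
    then obtain n where "n \<in> Poly_Mapping.keys p"
      and m: "m = (\<Sum>v\<in>UNIV. Poly_Mapping.single (Inl v) (Poly_Mapping.lookup n v))"
      by (auto simp: tincl_single split: if_splits)
    then have "mdeg n = e" using assms by (simp add: homogeneous_def)
    then show "(\<Sum>i\<in>UNIV. Poly_Mapping.lookup m (Inl i)) = e \<and>
        (\<Sum>j\<in>UNIV. Poly_Mapping.lookup m (Inr j)) = 0"
      unfolding m lookup_embed_exponent by (simp add: mdeg_def)
  qed
qed

section \<open>Generation and irredundancy\<close>

lemma ideal_subspace_iff:
  "ideal.subspace S \<longleftrightarrow>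
    0 \<in> S \<and> (\<forall>p\<in>S. \<forall>q\<in>S. p + q \<in> S) \<and> (\<forall>a. \<forall>p\<in>S. a * p \<in> S)"
  unfolding ideal.subspace_def by blast

lemma segre_hom_pminor: "segre_hom (pminor i j) = 0"
  unfolding pminor_def segre.diff segre.mult segre_hom_Var
  by (simp add: smult_monom mult.commute)

text \<open>Since \<open>X\<^sub>j\<close> goes to \<open>t\<^sub>j W\<close>, the sum of the
  \<open>g j\<close> times \<open>X\<^sub>j\<close> is mapped to \<open>fd W\<close> for every
  choice of the \<open>g j\<close>.\<close>

lemma segre_hom_F_start:
  fixes fd1 fd :: "('n::finite, 'k::field) mpoly"
  assumes "F_start d fd1 fd q"
  shows "segre_hom q = segre_equation fd1 fd"
proof -
  interpret c: ring_morphism "\<lambda>c::('n, 'k) mpoly poly. [:c:]" by (rule ring_morphism_const_poly)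
  obtain g where g: "fd = (\<Sum>j\<in>UNIV. Var j * g j)"
      "q = tincl fd1 * Xlast - (\<Sum>j\<in>UNIV. tincl (g j) * Xvar j)"
    using assms unfolding F_start_def by blast
  have "[:[:g j:]:] * [:monom (Var j) 1:] = [:monom (Var j * g j) 1:]" for j
    by (simp add: smult_monom mult.commute)
  then have "(\<Sum>j\<in>UNIV. [:[:g j:]:] * [:monom (Var j) 1:]) = [:monom fd 1:]"
    unfolding g(1) monom_sum c.sum by simp
  then show ?thesis
    unfolding g(2) segre.diff segre.mult segre.sum segre_hom_tincl segre_hom_Var
      segre_equation_altdef by (rule arg_cong)
qed

text \<open>Trading \<open>t\<^sub>i\<close> for \<open>X\<^sub>i\<close> multiplies the image of
  each summand by \<open>W\<close>, whatever decomposition was chosen.\<close>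

lemma segre_hom_F_step:
  fixes q q' :: "('n::finite, 'k::field) txpoly"
  assumes "F_step d j q q'"
  shows "segre_hom q' = segre_hom q * [:monom 1 1:]"
proof -
  obtain G where G: "q = (\<Sum>i\<in>UNIV. G i * tvar i)" "q' = (\<Sum>i\<in>UNIV. G i * Xvar i)"
    using assms unfolding F_step_def by blast
  have "[:monom (Var i) 1:] = [:[:Var i:]:] * [:monom 1 1 :: ('n, 'k) mpoly poly:]" for i
    by (simp add: smult_monom)
  then have "segre_hom (G i * Xvar i) = segre_hom (G i * tvar i) * [:monom 1 1:]" for i
    unfolding segre.mult segre_hom_Var by (simp only: mult.assoc)
  then show ?thesis
    unfolding G segre.sum sum_distrib_right by (rule sum.cong[OF refl])
qed

lemma segre_hom_F:
  fixes F :: "nat \<Rightarrow> ('n::finite, 'k::field) txpoly"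
  assumes F: "F_sequence d fd1 fd F" and "s \<le> d - 1"
  shows "segre_hom (F (d - 1 - s)) = segre_equation fd1 fd * [:monom 1 s:]"
  using \<open>s \<le> d - 1\<close>
proof (induction s)
  case 0
  have "[:monom 1 0:] = (1 :: ('n, 'k) mpoly poly poly)" by simp
  then show ?case using F segre_hom_F_start[of d fd1 fd "F (d - 1)"]
    by (simp only: F_sequence_def mult_1_right diff_zero)
next
  case (Suc s)
  have "d - 1 - s \<in> {1..d - 1}" using Suc.prems by auto
  then have "F_step d (d - 1 - s) (F (d - 1 - s)) (F (d - 1 - s - 1))"
    using F unfolding F_sequence_def by blast
  then have "segre_hom (F (d - 1 - s - 1)) = segre_hom (F (d - 1 - s)) * [:monom 1 1:]"
    by (rule segre_hom_F_step)
  also have "segre_hom (F (d - 1 - s)) = segre_equation fd1 fd * [:monom 1 s:]"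
    using Suc by simp
  also have "\<dots> * [:monom 1 1:] = segre_equation fd1 fd * ([:monom 1 s:] * [:monom 1 1:])"
    by (rule mult.assoc)
  also have "[:monom 1 s:] * [:monom 1 1:] = [:monom (1 :: ('n, 'k) mpoly) (Suc s):]"
    by (simp add: mult_monom)
  also have "d - 1 - s - 1 = d - 1 - Suc s" by simp
  finally show ?case .
qed

lemma segre_hom_F':
  assumes "F_sequence d fd1 fd F" "j \<le> d - 1"
  shows "segre_hom (F j) = segre_equation fd1 fd * [:monom 1 (d - 1 - j):]"
  using segre_hom_F[OF assms(1) diff_le_self[of "d - 1" j]]
  unfolding diff_diff_cancel[OF assms(2)] .

text \<open>If \<open>fd1\<close> were zero, \<open>fd\<close> would be a common factor and hence a
  unit, although all its terms have positive degree.\<close>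

lemma no_common_factor_nonzero:
  assumes "no_common_factor fd1 fd" "homogeneous d fd" "d \<ge> 1"
  shows "fd1 \<noteq> (0 :: ('n::finite, 'k::field) mpoly)"
proof
  assume "fd1 = 0"
  then have "fd dvd 1" using assms(1) unfolding no_common_factor_def by auto
  then obtain c where c: "1 = fd * c" ..
  have "min_degree_ge 0 c" by (simp add: min_degree_ge_def)
  with min_degree_ge_homogeneous[OF assms(2)] have "min_degree_ge (d + 0) (fd * c)"
    by (rule min_degree_ge_mult)
  then have "min_degree_ge d (1 :: ('n, 'k) mpoly)" unfolding c by simp
  then show False using assms(3) by (simp add: min_degree_ge_def mdeg_def)
qed

text \<open>An element \<open>q\<close> of the kernel has image \<open>E * w\<close>. Lifting
  \<open>w\<close> monomial by monomial yields \<open>r\<close> in the span with the same image, and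
  \<open>q - r\<close> is a combination of minors.\<close>

lemma rees_kernel_eq_span:
  fixes fd1 fd :: "('n::{finite,linorder}, 'k::field) mpoly"
  assumes d: "d \<ge> 1" and fd1: "homogeneous (d - 1) fd1" and fd: "homogeneous d fd"
    and coprime: "no_common_factor fd1 fd" and F: "F_sequence d fd1 fd F"
  shows "ideal.span (pminors \<union> {F j | j. j \<le> d - 1}) = rees_kernel fd1 fd"
proof
  interpret elim: ring_morphism "segre_elim fd1 fd" by (rule ring_morphism_segre_elim)
  have "ideal.subspace (rees_kernel fd1 fd)"
    unfolding ideal_subspace_iff rees_kernel_def rees_hom_eq_segre
    by (simp add: segre.add segre.mult elim.add elim.mult)
  moreover have "pminor i j \<in> rees_kernel fd1 fd" for i j
    by (simp add: rees_kernel_def rees_hom_eq_segre segre_hom_pminor)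
  moreover have "F j \<in> rees_kernel fd1 fd" if "j \<le> d - 1" for j
  proof -
    note segre_hom_F'[OF F that]
    then show ?thesis
      unfolding rees_kernel_def rees_hom_eq_segre by (simp only: mem_Collect_eq elim.mult
        segre_elim_equation mult_zero_left)
  qed
  ultimately show "ideal.span (pminors \<union> {F j | j. j \<le> d - 1}) \<subseteq> rees_kernel fd1 fd"
    by (intro ideal.span_minimal) auto
next
  let ?I = "ideal.span (pminors \<union> {F j | j. j \<le> d - 1})"
  have fd1_nz: "fd1 \<noteq> 0" by (rule no_common_factor_nonzero[OF coprime fd d])
  define lifts where
    "lifts w \<longleftrightarrow> (\<exists>r\<in>?I. segre_hom r = segre_equation fd1 fd * w)" for w
  have lifts_add: "lifts (v + w)" if "lifts v" "lifts w" for v w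
  proof -
    from that(1) obtain r where "r \<in> ?I" "segre_hom r = segre_equation fd1 fd * v"
      unfolding lifts_def ..
    moreover from that(2) obtain r' where "r' \<in> ?I" "segre_hom r' = segre_equation fd1 fd * w"
      unfolding lifts_def ..
    ultimately have "r + r' \<in> ?I" "segre_hom (r + r') = segre_equation fd1 fd * (v + w)"
      by (simp_all only: ideal.span_add segre.add distrib_left)
    then show ?thesis unfolding lifts_def ..
  qed
  have lifts_zero: "lifts 0"
    unfolding lifts_def by (rule bexI[of _ 0]) (simp_all add: ideal.span_zero)
  have lifts_sum: "lifts (sum f S)" if "\<And>i. i \<in> S \<Longrightarrow> lifts (f i)"
    for f :: "nat \<Rightarrow> ('n, 'k) mpoly poly poly" and S
    using that by (induction S rule: infinite_finite_induct) (simp_all add: lifts_zero lifts_add)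
  have lifts_sum': "lifts (sum f S)" if "\<And>i. i \<in> S \<Longrightarrow> lifts (f i)"
    for f :: "('n \<Rightarrow>\<^sub>0 nat) \<Rightarrow> ('n, 'k) mpoly poly poly" and S
    using that by (induction S rule: infinite_finite_induct) (simp_all add: lifts_zero lifts_add)
  have lifts_monom: "lifts (monom (monom (Poly_Mapping.single \<alpha> c) k) l)"
    if "k - (d - 1) \<le> mdeg \<alpha>" for \<alpha> c k l
  proof -
    \<comment> \<open>The excess of the power of \<open>W\<close> over the degree of \<alpha>, zero
      if there is none. It is supplied by \<open>F (d - 1 - s)\<close>, whose image is
      \<open>E\<close> times \<open>W\<close> to the power \<open>s\<close>; the remaining
      \<open>k - s\<close> factors lie in the image of \<open>segre_hom\<close>.\<close>
    define s where "s = k - mdeg \<alpha>"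
    have s: "s \<le> d - 1" "k - s \<le> mdeg \<alpha>" "s \<le> k" using that unfolding s_def by linarith+
    obtain q where q: "segre_hom q = monom (monom (Poly_Mapping.single \<alpha> c) (k - s)) l"
      using segre_hom_monomial_surj[OF s(2)] by blast
    have "segre_hom (q * F (d - 1 - s)) =
        segre_equation fd1 fd * ([:monom 1 s:] * monom (monom (Poly_Mapping.single \<alpha> c) (k - s)) l)"
      unfolding segre.mult q segre_hom_F[OF F s(1)] by (simp only: ac_simps)
    also have "[:monom 1 s:] * monom (monom (Poly_Mapping.single \<alpha> c) (k - s)) l
        = monom (monom (Poly_Mapping.single \<alpha> c) k) l"
      using s(3) by (simp add: smult_monom mult_monom)
    finally have "segre_hom (q * F (d - 1 - s)) =
      segre_equation fd1 fd * monom (monom (Poly_Mapping.single \<alpha> c) k) l" .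
    moreover have "F (d - 1 - s) \<in> pminors \<union> {F j | j. j \<le> d - 1}" by auto
    then have "q * F (d - 1 - s) \<in> ?I" by (intro ideal.span_scale ideal.span_base)
    ultimately show ?thesis unfolding lifts_def by blast
  qed
  show "rees_kernel fd1 fd \<subseteq> ?I"
  proof
    fix q assume "q \<in> rees_kernel fd1 fd"
    then have "segre_elim fd1 fd (segre_hom q) = 0"
      by (simp add: rees_kernel_def rees_hom_eq_segre)
    from segre_equation_dvd[OF coprime fd1_nz this] obtain w
      where w: "segre_hom q = segre_equation fd1 fd * w" ..
    \<comment> \<open>The weight bound on the quotient is the condition under which its monomials
      lift; \<open>w\<close> is then reassembled from them, first in \<open>t\<close>, then in
      \<open>W\<close>, then in \<open>X\<close>.\<close>
    have "lifts (monom (monom (Poly_Mapping.single \<alpha> (Poly_Mapping.lookup (coeff (coeff w l) k) \<alpha>)) k) l)"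
      if "\<alpha> \<in> Poly_Mapping.keys (coeff (coeff w l) k)" for l k \<alpha>
      using min_degree_ge_quotient[OF fd1 fd d fd1_nz w, of k l] that
      unfolding min_degree_ge_def by (intro lifts_monom) blast
    then have "lifts (monom (monom (\<Sum>\<alpha>\<in>Poly_Mapping.keys (coeff (coeff w l) k).
        Poly_Mapping.single \<alpha> (Poly_Mapping.lookup (coeff (coeff w l) k) \<alpha>)) k) l)" for l k
      unfolding monom_sum by (rule lifts_sum')
    then have "lifts (monom (monom (coeff (coeff w l) k) k) l)" for l k
      by (simp only: mpoly_sum_singles[symmetric])
    then have "lifts (monom (\<Sum>k\<le>degree (coeff w l). monom (coeff (coeff w l) k) k) l)" for l
      unfolding monom_sum by (rule lifts_sum)
    then have "lifts (monom (coeff w l) l)" for l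
      by (simp only: poly_as_sum_of_monoms)
    then have "lifts (\<Sum>l\<le>degree w. monom (coeff w l) l)" by (rule lifts_sum)
    then have "lifts w" by (simp only: poly_as_sum_of_monoms)
    then obtain r where r: "r \<in> ?I" "segre_hom r = segre_equation fd1 fd * w"
      unfolding lifts_def by blast
    have "segre_hom (q - r) = 0" unfolding segre.diff w r(2) by simp
    then have "q - r \<in> ideal.span pminors" by (rule span_pminors_if_segre_hom_zero)
    then have "q - r \<in> ?I" using ideal.span_mono[of pminors "pminors \<union> {F j | j. j \<le> d - 1}"] by blast
    then have "(q - r) + r \<in> ?I" using r(1) by (rule ideal.span_add)
    then show "q \<in> ?I" by simp
  qed
qed

text \<open>\<open>M\<close> consists of the elements with image \<open>E * w\<close> in which
  \<open>w\<close> lacks the pure power of \<open>W\<close> with exponent \<open>s\<close>. It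
  contains the minors, with \<open>w = 0\<close>, and every other \<open>F k\<close>, with a
  different power of \<open>W\<close>, but not \<open>F j\<close>.\<close>

lemma F_not_redundant:
  fixes fd1 fd :: "('n::{finite,linorder}, 'k::field) mpoly"
  assumes fd1: "fd1 \<noteq> 0" and F: "F_sequence d fd1 fd F" and j: "j \<le> d - 1"
  shows "F j \<notin> ideal.span ((pminors \<union> {F j | j. j \<le> d - 1}) - {F j})"
proof
  define s where "s = d - 1 - j"
  define M where "M = {q. \<exists>w. segre_hom q = segre_equation fd1 fd * w \<and>
    Poly_Mapping.lookup (coeff (coeff w 0) s) 0 = 0}"
  note F_eq = segre_hom_F'[OF F]
  have M: "ideal.subspace M"
    unfolding ideal_subspace_iff
  proof (intro conjI ballI allI)
    show "0 \<in> M" unfolding M_def by (intro CollectI exI[of _ 0]) simp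
    fix p assume "p \<in> M"
    then obtain v where v: "segre_hom p = segre_equation fd1 fd * v"
      "Poly_Mapping.lookup (coeff (coeff v 0) s) 0 = 0" unfolding M_def by blast
    show "p + q \<in> M" if "q \<in> M" for q
    proof -
      obtain w where w: "segre_hom q = segre_equation fd1 fd * w"
        "Poly_Mapping.lookup (coeff (coeff w 0) s) 0 = 0" using \<open>q \<in> M\<close> unfolding M_def by blast
      show ?thesis unfolding M_def
        by (intro CollectI exI[of _ "v + w"])
          (simp add: segre.add v w lookup_add distrib_left)
    qed
    show "a * p \<in> M" for a
    proof -
      \<comment> \<open>For \<open>i > 0\<close> the coefficient of the image of \<open>a\<close>
        has order at least \<open>i\<close> in \<open>t\<close>, hence no constant term; for
        \<open>i = 0\<close> the condition on \<open>v\<close> applies. This makes \<open>M\<close>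
        an ideal.\<close>
      have "Poly_Mapping.lookup (coeff (coeff (segre_hom a) 0) i * coeff (coeff v 0) (s - i)) 0 = 0" for i
      proof (cases i)
        case 0
        then show ?thesis using v(2) by (simp add: lookup_mult_zero)
      next
        case (Suc i')
        have "(0 :: 'n \<Rightarrow>\<^sub>0 nat) \<notin> Poly_Mapping.keys (coeff (coeff (segre_hom a) 0) i)"
          using min_degree_ge_segre_hom[of i a 0] Suc unfolding min_degree_ge_def
          by (auto simp: mdeg_def)
        then show ?thesis by (simp add: lookup_mult_zero in_keys_iff)
      qed
      then have "Poly_Mapping.lookup (coeff (coeff (segre_hom a * v) 0) s) 0 = 0"
        by (simp add: coeff_mult lookup_sum)
      moreover have "segre_hom (a * p) = segre_equation fd1 fd * (segre_hom a * v)"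
        unfolding segre.mult v(1) by (rule mult.left_commute)
      ultimately show ?thesis unfolding M_def by blast
    qed
  qed
  have "(pminors \<union> {F j | j. j \<le> d - 1}) - {F j} \<subseteq> M"
  proof
    fix q assume q: "q \<in> (pminors \<union> {F j | j. j \<le> d - 1}) - {F j}"
    then consider i k where "q = pminor i k" | k where "q = F k" "k \<le> d - 1" "k \<noteq> j"
      by blast
    then show "q \<in> M"
    proof cases
      case 1
      then show ?thesis unfolding M_def by (intro CollectI exI[of _ 0]) (simp add: segre_hom_pminor)
    next
      case 2
      have "Poly_Mapping.lookup (coeff (coeff [:monom 1 (d - 1 - k) :: ('n, 'k) mpoly poly:] 0) s) 0 = 0"
        using 2 j by (simp add: s_def)
      then show ?thesis unfolding M_def 2(1) using F_eq[OF 2(2)] by blast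
    qed
  qed
  then have sub: "ideal.span ((pminors \<union> {F j | j. j \<le> d - 1}) - {F j}) \<subseteq> M"
    using M by (rule ideal.span_minimal)
  assume "F j \<in> ideal.span ((pminors \<union> {F j | j. j \<le> d - 1}) - {F j})"
  with sub have "F j \<in> M" by blast
  then obtain w where w: "segre_hom (F j) = segre_equation fd1 fd * w"
    "Poly_Mapping.lookup (coeff (coeff w 0) s) 0 = 0" unfolding M_def by blast
  \<comment> \<open>In a domain the quotient by \<open>E\<close> is unique.\<close>
  have "segre_equation fd1 fd \<noteq> 0" using fd1 by (simp add: segre_equation_def)
  moreover have "segre_equation fd1 fd * [:monom 1 s:] = segre_equation fd1 fd * w"
    using w(1) F_eq[OF j] unfolding s_def by metis
  ultimately have "w = [:monom 1 s:]" using mult_left_cancel by metis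
  then show False using w(2) by simp
qed

section \<open>Low coefficients of the generators and irredundancy of the minors\<close>

lemma bihomogeneous_lookup_eq_zero:
  assumes "bihomogeneous a b p"
  shows "a + b \<noteq> 0 \<Longrightarrow> Poly_Mapping.lookup p 0 = 0"
    and "a \<noteq> 1 \<or> b \<noteq> 0 \<Longrightarrow> Poly_Mapping.lookup p (expo (Inl i)) = 0"
    and "a \<noteq> 0 \<or> b \<noteq> 1 \<Longrightarrow> Poly_Mapping.lookup p (expo (Inr j)) = 0"
    and "a \<noteq> 1 \<or> b \<noteq> 1 \<Longrightarrow> Poly_Mapping.lookup p (expo (Inl i) + expo (Inr j)) = 0"
proof -
  note deg = bihomogeneous_degrees[OF assms]
  have t: "(\<Sum>k\<in>UNIV. Poly_Mapping.lookup (expo (Inl i) :: 'a + 'a option \<Rightarrow>\<^sub>0 nat) (Inl k)) = 1"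
    "(\<Sum>k\<in>UNIV. Poly_Mapping.lookup (expo (Inl i) :: 'a + 'a option \<Rightarrow>\<^sub>0 nat) (Inr k)) = 0"
    and x: "(\<Sum>k\<in>UNIV. Poly_Mapping.lookup (expo (Inr j) :: 'a + 'a option \<Rightarrow>\<^sub>0 nat) (Inl k)) = 0"
    "(\<Sum>k\<in>UNIV. Poly_Mapping.lookup (expo (Inr j) :: 'a + 'a option \<Rightarrow>\<^sub>0 nat) (Inr k)) = 1"
    by (simp_all add: lookup_single when_def sum.delta')
  show "a + b \<noteq> 0 \<Longrightarrow> Poly_Mapping.lookup p 0 = 0"
    using deg[of 0] by auto
  show "a \<noteq> 1 \<or> b \<noteq> 0 \<Longrightarrow> Poly_Mapping.lookup p (expo (Inl i)) = 0"
    using deg[of "expo (Inl i)", unfolded t] by metis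
  show "a \<noteq> 0 \<or> b \<noteq> 1 \<Longrightarrow> Poly_Mapping.lookup p (expo (Inr j)) = 0"
    using deg[of "expo (Inr j)", unfolded x] by metis
  show "a \<noteq> 1 \<or> b \<noteq> 1 \<Longrightarrow> Poly_Mapping.lookup p (expo (Inl i) + expo (Inr j)) = 0"
    using deg[of "expo (Inl i) + expo (Inr j)", unfolded lookup_add sum.distrib t x] by fastforce
qed

text \<open>\<open>F_step\<close> prescribes the bidegree of its coefficients \<open>G i\<close>, so
  a case distinction replaces an induction.\<close>

lemma bihomogeneous_F:
  fixes F :: "nat \<Rightarrow> ('n::finite, 'k::field) txpoly"
  assumes "homogeneous (d - 1) fd1" "F_sequence d fd1 fd F" "d \<ge> 1" "j \<le> d - 1"
  shows "bihomogeneous j (d - j) (F j)"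
proof (cases "j = d - 1")
  case True
  obtain g where g: "\<And>j. homogeneous (d - 1) (g j)"
      "F (d - 1) = tincl fd1 * Xlast - (\<Sum>j\<in>UNIV. tincl (g j) * Xvar j)"
    using assms(2) unfolding F_sequence_def F_start_def by blast
  have "bihomogeneous (d - 1 + 0) (0 + 1) (F (d - 1))"
    unfolding g(2)
    by (intro bihomogeneous_diff bihomogeneous_sum bihomogeneous_mult bihomogeneous_X
      bihomogeneous_tincl assms(1) g(1))
  moreover have "d - j = 1" using True assms(3) by linarith
  ultimately show ?thesis using True by simp
next
  case False
  then have "Suc j \<in> {1..d - 1}" using assms by auto
  then have "F_step d (Suc j) (F (Suc j)) (F j)"
    using assms(2) unfolding F_sequence_def by fastforce
  then obtain G where G: "\<And>i. bihomogeneous (Suc j - 1) (d - Suc j) (G i)"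
      "F j = (\<Sum>i\<in>UNIV. G i * Xvar i)" unfolding F_step_def by blast
  have "bihomogeneous (Suc j - 1 + 0) (d - Suc j + 1) (F j)"
    unfolding G(2) by (intro bihomogeneous_sum bihomogeneous_mult bihomogeneous_X G(1))
  moreover have "d - Suc j + 1 = d - j" using \<open>Suc j \<in> {1..d - 1}\<close> by auto
  ultimately show ?thesis by simp
qed

lemma bihomogeneous_pminor: "bihomogeneous 1 1 (pminor i j :: ('n::finite, 'k::field) txpoly)"
proof -
  have t: "bihomogeneous 1 0 (tvar i :: ('n, 'k) txpoly)" for i
    by (simp add: bihomogeneous_def Var_def lookup_single when_def sum.delta')
  have "bihomogeneous (1 + 0) (0 + 1) (pminor i j :: ('n, 'k) txpoly)"
    unfolding pminor_def
    by (intro bihomogeneous_diff bihomogeneous_mult t bihomogeneous_X)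
  then show ?thesis by simp
qed

lemma lookup_mult_Var_expo_pair:
  fixes p :: "('n::finite, 'k::field) txpoly"
  shows "Poly_Mapping.lookup (p * Var (Inr j)) (expo (Inl k) + expo (Inr l)) =
    (if j = l then Poly_Mapping.lookup p (expo (Inl k)) else 0)"
proof -
  have "expo (Inl k) + expo (Inr l) \<noteq> expo (Inr j :: 'n + 'n option)"
    by (rule expo_pair_neq_single)
  then show ?thesis
    by (subst lookup_mult_expo_pair) (simp_all add: lookup_Var expo_eq_iff)
qed

lemma lookup_pminor:
  "Poly_Mapping.lookup (pminor k l :: ('n::finite, 'k::field) txpoly) (expo (Inl i) + expo (Inr j)) =
    (if k = i \<and> Some l = j then 1 else 0) - (if l = i \<and> Some k = j then 1 else 0)"
  unfolding pminor_def lookup_minus lookup_mult_Var_expo_pair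
  by (simp add: lookup_Var expo_eq_iff)

text \<open>The last variable occurs only in \<open>tincl fd1 * Xlast\<close>, so these coefficients
  come from \<open>fd1\<close>.\<close>

lemma lookup_F_start:
  assumes "F_start d fd1 fd q"
  shows "Poly_Mapping.lookup q (expo (Inl k) + expo (Inr None)) = Poly_Mapping.lookup fd1 (expo k)"
    and "Poly_Mapping.lookup q (expo (Inr None)) = Poly_Mapping.lookup fd1 0"
proof -
  obtain g where g: "q = tincl fd1 * Xlast - (\<Sum>j\<in>UNIV. tincl (g j) * Xvar j)"
    using assms unfolding F_start_def by blast
  show "Poly_Mapping.lookup q (expo (Inl k) + expo (Inr None)) = Poly_Mapping.lookup fd1 (expo k)"
    unfolding g lookup_minus lookup_sum lookup_mult_Var_expo_pair by (simp add: lookup_tincl_expo)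
  show "Poly_Mapping.lookup q (expo (Inr None)) = Poly_Mapping.lookup fd1 0"
    unfolding g lookup_minus lookup_sum lookup_mult_expo
    by (simp add: lookup_tincl_zero lookup_Var expo_eq_iff)
qed

lemma homogeneous_zero_lookup:
  fixes p :: "('v::finite, 'k::zero) mpoly"
  assumes "homogeneous 0 p" "p \<noteq> 0"
  shows "Poly_Mapping.lookup p 0 \<noteq> 0"
proof -
  obtain m where m: "m \<in> Poly_Mapping.keys p" using assms(2) keys_eq_empty[of p] by blast
  then have "mdeg m = 0" using assms(1) by (simp add: homogeneous_def)
  then have "m = 0" by (intro poly_mapping_eqI) (simp add: mdeg_def)
  then show ?thesis using m by (simp add: in_keys_iff)
qed

lemma homogeneous_one_lookup:
  fixes p :: "('v::finite, 'k::zero) mpoly"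
  assumes "homogeneous 1 p" "p \<noteq> 0"
  obtains v where "Poly_Mapping.lookup p (expo v) \<noteq> 0"
proof -
  obtain m where m: "m \<in> Poly_Mapping.keys p" using assms(2) keys_eq_empty[of p] by blast
  then have deg: "mdeg m = 1" using assms(1) by (simp add: homogeneous_def)
  then have "\<exists>v. Poly_Mapping.lookup m v > 0"
    unfolding mdeg_def by (metis gr0I sum.neutral zero_neq_one)
  then obtain v where "Poly_Mapping.lookup m v > 0" ..
  then obtain m' where m': "m = Poly_Mapping.single v 1 + m'" by (rule exponent_split)
  then have "mdeg m' = 0" using deg by (simp add: mdeg_add mdeg_single)
  then have "m' = 0" by (intro poly_mapping_eqI) (simp add: mdeg_def)
  then show ?thesis using m m' that[of v] by (simp add: in_keys_iff)
qed

text \<open>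
  \<open>F\<^sub>1\<close> (for \<open>d = 2\<close>) and the multiples of \<open>F\<^sub>0\<close> (for \<open>d = 1\<close>) may contain the monomial \<open>t\<^sub>i X\<^sub>j\<close>, but
  also contain a monomial \<open>t\<^sub>k X\<^sub>n\<^sub>+\<^sub>1\<close>, which occurs in no minor; \<open>y\<close> is the quotient of the two
  coefficients. Only for \<open>d = 1\<close>, with \<open>k = i\<close>, do terms linear in \<open>X\<close> have to be admitted.
\<close>

definition pminor_separator ::
  "'n \<Rightarrow> 'n \<Rightarrow> 'n \<Rightarrow> 'k::field \<Rightarrow> ('n::finite, 'k) txpoly set" where
  "pminor_separator i j k y = {q. Poly_Mapping.lookup q 0 = 0 \<and>
     (\<forall>v. Poly_Mapping.lookup q (expo (Inl v)) = 0) \<and>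
     Poly_Mapping.lookup q (expo (Inr (Some j))) = y * Poly_Mapping.lookup q (expo (Inr None)) \<and>
     (k = i \<or> Poly_Mapping.lookup q (expo (Inr None)) = 0) \<and>
     Poly_Mapping.lookup q (expo (Inl i) + expo (Inr (Some j)))
       = y * Poly_Mapping.lookup q (expo (Inl k) + expo (Inr None))}"

text \<open>As \<open>p\<close> has no constant term and no terms linear in \<open>t\<close>, its
  coefficient at \<open>t\<^sub>u X\<^sub>v\<close> becomes, in \<open>a * p\<close>, the constant
  term of \<open>a\<close> times it plus the coefficient of \<open>a\<close> at
  \<open>t\<^sub>u\<close> times that of \<open>p\<close> at \<open>X\<^sub>v\<close>. The extra
  terms for the two exponents have ratio \<open>y\<close> if \<open>k = i\<close> and vanish
  otherwise.\<close>

lemma subspace_pminor_separator: "ideal.subspace (pminor_separator i j k y)"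
  unfolding ideal_subspace_iff
proof (intro conjI ballI allI)
  show "0 \<in> pminor_separator i j k y" by (simp add: pminor_separator_def)
  fix p assume p: "p \<in> pminor_separator i j k y"
  note p' = p[unfolded pminor_separator_def mem_Collect_eq]
  show "p + q \<in> pminor_separator i j k y" if "q \<in> pminor_separator i j k y" for q
  proof -
    note q' = that[unfolded pminor_separator_def mem_Collect_eq]
    show ?thesis
      unfolding pminor_separator_def mem_Collect_eq lookup_add distrib_left using p' q' by auto
  qed
  show "a * p \<in> pminor_separator i j k y" for a
  proof -
    from p' have p_zero: "Poly_Mapping.lookup p 0 = 0" "Poly_Mapping.lookup p (expo (Inl v)) = 0"
      and X: "Poly_Mapping.lookup p (expo (Inr (Some j))) = y * Poly_Mapping.lookup p (expo (Inr None))"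
      and tX: "Poly_Mapping.lookup p (expo (Inl i) + expo (Inr (Some j)))
       = y * Poly_Mapping.lookup p (expo (Inl k) + expo (Inr None))"
      and k: "k = i \<or> Poly_Mapping.lookup p (expo (Inr None)) = 0" for v
      by blast+
    have pair: "Poly_Mapping.lookup (a * p) (expo (Inl u) + expo (Inr v)) =
        Poly_Mapping.lookup a 0 * Poly_Mapping.lookup p (expo (Inl u) + expo (Inr v))
        + Poly_Mapping.lookup a (expo (Inl u)) * Poly_Mapping.lookup p (expo (Inr v))" for u v
      by (subst lookup_mult_expo_pair) (simp_all add: p_zero)
    have "Poly_Mapping.lookup (a * p) (expo (Inl i) + expo (Inr (Some j)))
       = y * Poly_Mapping.lookup (a * p) (expo (Inl k) + expo (Inr None))"
      using k
    proof
      assume "k = i"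
      show ?thesis unfolding pair tX X unfolding \<open>k = i\<close> by (simp only: distrib_left ac_simps)
    next
      assume zero: "Poly_Mapping.lookup p (expo (Inr None)) = 0"
      show ?thesis unfolding pair tX X unfolding zero by simp
    qed
    moreover have "Poly_Mapping.lookup (a * p) 0 = 0"
      unfolding lookup_mult_zero p_zero by simp
    moreover have "Poly_Mapping.lookup (a * p) (expo (Inl v)) = 0" for v
      unfolding lookup_mult_expo p_zero by simp
    moreover have "Poly_Mapping.lookup (a * p) (expo (Inr (Some j))) =
        y * Poly_Mapping.lookup (a * p) (expo (Inr None))"
      unfolding lookup_mult_expo p_zero X by simp
    moreover have "k = i \<or> Poly_Mapping.lookup (a * p) (expo (Inr None)) = 0"
      unfolding lookup_mult_expo p_zero using k by auto
    ultimately show ?thesis unfolding pminor_separator_def by blast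
  qed
qed

text \<open>For suitable \<open>k\<close> and \<open>y\<close> the ideal
  \<open>pminor_separator i j k y\<close> contains every \<open>F l\<close>. It contains the other
  minors because they involve neither \<open>t\<^sub>i X\<^sub>j\<close> nor the last variable, but
  not \<open>pminor i j\<close>, which has coefficient one at
  \<open>t\<^sub>i X\<^sub>j\<close>.\<close>

lemma pminor_not_redundant:
  fixes fd1 fd :: "('n::{finite,linorder}, 'k::field) mpoly"
  assumes d: "d \<ge> 1" and fd1: "homogeneous (d - 1) fd1" "fd1 \<noteq> 0"
    and F: "F_sequence d fd1 fd F" and ij: "i < j"
  shows "pminor i j \<notin> ideal.span ((pminors \<union> {F j | j. j \<le> d - 1}) - {pminor i j})"
proof
  assume in_span: "pminor i j \<in> ideal.span ((pminors \<union> {F j | j. j \<le> d - 1}) - {pminor i j})"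
  have bihom: "bihomogeneous l (d - l) (F l)" if "l \<le> d - 1" for l
    using bihomogeneous_F[OF fd1(1) F d that] .
  have start: "F_start d fd1 fd (F (d - 1))" using F by (simp add: F_sequence_def)
  have "\<exists>k y. \<forall>l\<le>d - 1. F l \<in> pminor_separator i j k y"
  proof -
    consider "d = 1" | "d = 2" | "d \<ge> 3" using d by linarith
    then show ?thesis
    proof cases
      case 1
      \<comment> \<open>Now \<open>fd1\<close> is a nonzero constant, so the denominator is nonzero.
        As \<open>F 0\<close> is linear in \<open>X\<close>, the only nontrivial condition is the
        one that defines \<open>y\<close>.\<close>
      define y where "y = Poly_Mapping.lookup (F 0) (expo (Inr (Some j)))
        / Poly_Mapping.lookup (F 0) (expo (Inr None))"
      have nz: "Poly_Mapping.lookup (F 0) (expo (Inr None)) \<noteq> 0"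
        using lookup_F_start(2)[OF start] homogeneous_zero_lookup[of fd1] fd1 1 by simp
      have "bihomogeneous 0 1 (F 0)" using bihom[of 0] 1 by simp
      note zero = bihomogeneous_lookup_eq_zero(1,2,4)[OF this]
      have "F 0 \<in> pminor_separator i j i y"
        using nz zero by (simp add: pminor_separator_def y_def)
      then show ?thesis using 1 by auto
    next
      case 2
      \<comment> \<open>Now \<open>fd1\<close> is a nonzero linear form; a variable
        \<open>t\<^sub>k\<close> occurring in it makes
        \<open>t\<^sub>k X\<^sub>n\<^sub>+\<^sub>1\<close> occur in \<open>F 1\<close>. All
        coefficients of \<open>F 0\<close> in question are zero, since its bidegree is
        \<open>(0, 2)\<close>.\<close>
      obtain k where k: "Poly_Mapping.lookup fd1 (expo k) \<noteq> 0"
        using homogeneous_one_lookup[of fd1] fd1 2 by auto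
      define y where "y = Poly_Mapping.lookup (F 1) (expo (Inl i) + expo (Inr (Some j)))
        / Poly_Mapping.lookup (F 1) (expo (Inl k) + expo (Inr None))"
      have nz: "Poly_Mapping.lookup (F 1) (expo (Inl k) + expo (Inr None)) \<noteq> 0"
        using lookup_F_start(1)[OF start, of k] k 2 by simp
      have "bihomogeneous 1 1 (F 1)" using bihom[of 1] 2 by simp
      note zero = bihomogeneous_lookup_eq_zero(1,2,3)[OF this]
      have F1: "F 1 \<in> pminor_separator i j k y"
        using nz zero by (simp add: pminor_separator_def y_def)
      have "bihomogeneous 0 2 (F 0)" using bihom[of 0] 2 by simp
      note zero = bihomogeneous_lookup_eq_zero[OF this]
      have F0: "F 0 \<in> pminor_separator i j k y"
        using zero by (simp add: pminor_separator_def)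
      have "F l \<in> pminor_separator i j k y" if "l \<le> d - 1" for l
      proof -
        have "l = 0 \<or> l = 1" using that 2 by linarith
        then show ?thesis using F0 F1 by blast
      qed
      then show ?thesis by blast
    next
      case 3
      \<comment> \<open>All \<open>F l\<close> have total degree \<open>d\<close>, at least three,
        so every coefficient involved is zero.\<close>
      have "F l \<in> pminor_separator i j i 0" if "l \<le> d - 1" for l
      proof -
        have "l + (d - l) \<noteq> 0" "l \<noteq> 1 \<or> d - l \<noteq> 0" "l \<noteq> 0 \<or> d - l \<noteq> 1" "l \<noteq> 1 \<or> d - l \<noteq> 1"
          using 3 that by linarith+
        then show ?thesis
          using bihomogeneous_lookup_eq_zero[OF bihom[OF that]] by (simp add: pminor_separator_def)
      qed
      then show ?thesis by blast
    qed
  qed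
  then obtain k y where Fl: "\<And>l. l \<le> d - 1 \<Longrightarrow> F l \<in> pminor_separator i j k y" by blast
  have zero: "Poly_Mapping.lookup (pminor a b :: ('n, 'k) txpoly) 0 = 0"
    "Poly_Mapping.lookup (pminor a b :: ('n, 'k) txpoly) (expo (Inl u)) = 0"
    "Poly_Mapping.lookup (pminor a b :: ('n, 'k) txpoly) (expo (Inr v)) = 0" for a b u v
    by (rule bihomogeneous_lookup_eq_zero[OF bihomogeneous_pminor]; simp)+
  have "(pminors \<union> {F j | j. j \<le> d - 1}) - {pminor i j} \<subseteq> pminor_separator i j k y"
  proof
    fix q assume "q \<in> (pminors \<union> {F j | j. j \<le> d - 1}) - {pminor i j}"
    then consider a b where "q = pminor a b" "a < b" "(a, b) \<noteq> (i, j)" | l where "q = F l" "l \<le> d - 1"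
      by blast
    then show "q \<in> pminor_separator i j k y"
    proof cases
      case 1
      from 1(3) have ne: "\<not> (a = i \<and> b = j)" by blast
      have ne': "\<not> (b = i \<and> a = j)"
      proof
        assume "b = i \<and> a = j"
        then have "j < i" using 1(2) by blast
        then show False by (rule less_asym'[OF ij])
      qed
      have "(if a = i \<and> Some b = Some j then 1 else 0) - (if b = i \<and> Some a = Some j then 1 else 0)
          = (0 :: 'k)"
        unfolding option.inject if_not_P[OF ne] if_not_P[OF ne'] by simp
      then show ?thesis
        unfolding 1(1) pminor_separator_def mem_Collect_eq lookup_pminor zero by simp
    qed (simp add: Fl)
  qed
  then have "ideal.span ((pminors \<union> {F j | j. j \<le> d - 1}) - {pminor i j}) \<subseteq> pminor_separator i j k y"
    using subspace_pminor_separator by (rule ideal.span_minimal)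
  with in_span have "pminor i j \<in> pminor_separator i j k y" by blast
  moreover have "i \<noteq> j" using ij by simp
  ultimately show False by (simp add: pminor_separator_def lookup_pminor)
qed

theorem theorem3p1:
  fixes d :: nat
    and H :: "('n::{finite,linorder} option \<Rightarrow> 'k::alg_closed_field) set set"
    and fd1 fd :: "('n, 'k) mpoly"
    and F :: "nat \<Rightarrow> ('n, 'k) txpoly"
  assumes "d \<ge> 1"
    and "monoid_hypersurface d H monoid_vertex"
    and "homogeneous (d - 1) fd1"
    and "homogeneous d fd"
    and "no_common_factor fd1 fd"
    and "implicit_equation H (monoid_equation fd1 fd)"
    and "F_sequence d fd1 fd F"
  shows "minimal_generators ({pminor i j | i j. i < j} \<union> {F j | j. j \<le> d - 1})
           (rees_kernel fd1 fd)"
  unfolding minimal_generators_def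
proof (intro conjI ballI)
  show "ideal.span (pminors \<union> {F j | j. j \<le> d - 1}) = rees_kernel fd1 fd"
    by (rule rees_kernel_eq_span[OF assms(1,3,4,5,7)])
  have fd1: "fd1 \<noteq> 0" by (rule no_common_factor_nonzero[OF assms(5,4,1)])
  fix b assume "b \<in> pminors \<union> {F j | j. j \<le> d - 1}"
  then consider i j where "b = pminor i j" "i < j" | j where "b = F j" "j \<le> d - 1" by blast
  then show "b \<notin> ideal.span (pminors \<union> {F j | j. j \<le> d - 1} - {b})"
  proof cases
    case 1
    then show ?thesis using pminor_not_redundant[OF assms(1,3) fd1 assms(7)] by simp
  next
    case 2
    then show ?thesis using F_not_redundant[OF fd1 assms(7)] by simp
  qed
qed

end
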